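(* Let $p$ be a prime, $d\ge1$, let $\widetilde d$ be a (deformed) ultrametric on $\mathbb{Q}_p^d$, and let $A$ be a $d\times d$ matrix with integer entries which is a dilation of $\mathbb{Q}_p^d$ with respect to $\widetilde d$, with $|\det A|_p=p^{-1}$. Let $\mathcal{D}=\{n_0,\dots,n_{p-1}\}\subset\mathbb{Z}^d$ be an arbitrary fixed set of digits, i.e. vectors with integer coordinates which represent all elements of $\mathbb{Z}_p^d/A\mathbb{Z}_p^d$, and let $\rho$ be the map of $\mathbb{Q}_p^d$ to a subset of $\mathbb{R}^d$ given by $$\rho:\ \sum_{i=\gamma}^\infty A^ix_i\ \mapsto\ \sum_{i=\gamma}^\infty A^{-i-1}x_i,\qquad \gamma\in\mathbb{Z},\ x_i\in\mathcal{D}.$$ Let the following two conditions be satisfied: (A) the subset $R=\left\{\sum_{i=0}^\infty A^{-i-1}x_i\right\}$ of $\mathbb{R}^d$, where the $x_i$ are the digits (integer representatives from $\mathbb{Z}^d/A\mathbb{Z}^d$), is Lebesgue measurable with measure equal to one; (B) the Lebesgue measure of the intersection $R\cap(R+k)$ is equal to zero for all nonzero $k\in\mathbb{Z}^d$. Then the map $\rho$ conserves the measure, i.e. the Lebesgue measure of the image of a set is equal to the Haar measure of this set.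
   Context: $|x|_p=\max_l|x_l|_p$ on $\mathbb{Q}_p^d$. The Haar measure on $\mathbb{Q}_p^d$ is normalized so that $\mathbb{Z}_p^d$ has measure one. A deformed ultrametric on $\mathbb{Q}_p^d$ is a metric of the form $\widetilde d(x,y)=\max_{1\le l\le d} q_l|(Ux)_l-(Uy)_l|_p$ with $p^{-1}<q_l\le 1$ and $U\in O_d$, where $O_d$ is the group of linear transformations of $\mathbb{Q}_p^d$ preserving $|\cdot|_p$ (equivalently, matrices with entries in $\mathbb{Z}_p$ and $|\det|_p=1$). A dilation with respect to $\widetilde d$ is a linear map $\mathbb{Q}_p^d\to\mathbb{Q}_p^d$ which maps any $\widetilde d$-ball (of positive radius) with center at zero onto a maximal proper $\widetilde d$-subball with center at zero of this ball. The map $\rho$ is defined through the representation of the elements of $\mathbb{Q}_p^d$ as series $\sum_{i=\gamma}^\infty A^ix_i$ with digits $x_i\in\mathcal{D}$; since the digits and the matrix elements of $A$ are rational integers, $\rho$ is taken to be correctly defined. It depends on the choice of the digits. *)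

theory Defs
  imports "HOL-Analysis.Analysis" "HOL-Computational_Algebra.Squarefree"
begin

section \<open>The $p$-adic absolute value on the rationals\<close>

definition rat_pval :: "nat \<Rightarrow> rat \<Rightarrow> int" where
  "rat_pval p x =
     int (multiplicity (int p) (fst (quotient_of x))) - int (multiplicity (int p) (snd (quotient_of x)))"

definition rat_pabs :: "nat \<Rightarrow> rat \<Rightarrow> real" where
  "rat_pabs p x = (if x = 0 then 0 else real p powi (- rat_pval p x))"

lemma rat_pval_frac:
  assumes "prime p" "a \<noteq> 0" "b \<noteq> 0"
  shows "rat_pval p (of_int a / of_int b) =
    int (multiplicity (int p) a) - int (multiplicity (int p) b)"
proof -
  have P: "prime_elem (int p)" using assms(1) by auto
  define x :: rat where "x = of_int a / of_int b"
  obtain c d where cd: "quotient_of x = (c, d)" by force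
  have d: "d > 0" and x: "x = of_int c / of_int d"
    using quotient_of_denom_pos[OF cd] quotient_of_div[OF cd] by auto
  have "x \<noteq> 0" using assms by (simp add: x_def)
  then have c: "c \<noteq> 0" using x by auto
  have "(of_int a * of_int d :: rat) = of_int c * of_int b"
    using x assms d unfolding x_def by (simp add: field_simps)
  then have eq: "a * d = c * b" by (metis of_int_eq_iff of_int_mult)
  have "multiplicity (int p) a + multiplicity (int p) d = multiplicity (int p) c + multiplicity (int p) b"
    using prime_elem_multiplicity_mult_distrib[OF P, of a d]
      prime_elem_multiplicity_mult_distrib[OF P, of c b] eq assms c d by auto
  then show ?thesis unfolding rat_pval_def x_def[symmetric] cd by simp
qed

lemma rat_pabs_0 [simp]: "rat_pabs p 0 = 0"
  by (simp add: rat_pabs_def)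

lemma rat_pabs_1 [simp]: "rat_pabs p 1 = 1"
  by (simp add: rat_pabs_def rat_pval_def)

lemma rat_pabs_pos: "prime p \<Longrightarrow> x \<noteq> 0 \<Longrightarrow> rat_pabs p x > 0"
  by (simp add: rat_pabs_def prime_gt_0_nat)

lemma rat_pabs_nonneg [simp]: "rat_pabs p x \<ge> 0"
  by (simp add: rat_pabs_def)

lemma rat_pabs_minus [simp]: "rat_pabs p (- x) = rat_pabs p x"
  by (cases "quotient_of x")
     (simp add: rat_pabs_def rat_pval_def rat_uminus_code )

lemma rat_as_frac: obtains a b where "b \<noteq> 0" "(x::rat) = of_int a / of_int b"
  using quotient_of_div[of x] quotient_of_denom_pos[of x] by (metis less_irrefl prod.collapse)

lemma rat_pabs_mult:
  assumes "prime p" shows "rat_pabs p (x * y) = rat_pabs p x * rat_pabs p y"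
proof (cases "x = 0 \<or> y = 0")
  case True
  then show ?thesis by auto
next
  case False
  have P: "prime_elem (int p)" using assms(1) by auto
  obtain a b where ab: "b \<noteq> 0" "x = of_int a / of_int b" by (rule rat_as_frac)
  obtain c d where cd: "d \<noteq> 0" "y = of_int c / of_int d" by (rule rat_as_frac)
  have a: "a \<noteq> 0" "c \<noteq> 0" using False ab cd by auto
  have xy: "x * y = of_int (a * c) / of_int (b * d)" using ab cd by simp
  have "rat_pval p (x * y) = rat_pval p x + rat_pval p y"
    unfolding xy unfolding ab(2) cd(2)
    using a ab(1) cd(1) assms
    by (simp add: rat_pval_frac prime_elem_multiplicity_mult_distrib[OF P] del: of_int_mult)
  then show ?thesis using False prime_gt_0_nat[OF assms]
    by (simp add: rat_pabs_def power_int_add[symmetric])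
qed

lemma rat_pabs_add_max:
  assumes "prime p" shows "rat_pabs p (x + y) \<le> max (rat_pabs p x) (rat_pabs p y)"
proof (cases "x = 0 \<or> y = 0 \<or> x + y = 0")
  case True
  then show ?thesis by (auto simp: le_max_iff_disj)
next
  case False
  have P: "prime_elem (int p)" using assms(1) by auto
  obtain a b where ab: "b \<noteq> 0" "x = of_int a / of_int b" by (rule rat_as_frac)
  obtain c d where cd: "d \<noteq> 0" "y = of_int c / of_int d" by (rule rat_as_frac)
  have a: "a \<noteq> 0" "c \<noteq> 0" using False ab cd by auto
  have xy: "x + y = of_int (a * d + c * b) / of_int (b * d)" using ab cd by (simp add: field_simps)
  have nz: "a * d + c * b \<noteq> 0" using False xy by (metis div_0 of_int_0)
  let ?v = "multiplicity (int p)"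
  let ?k = "min (?v (a * d)) (?v (c * b))"
  have "int p ^ ?k dvd a * d" "int p ^ ?k dvd c * b"
    by (auto intro: multiplicity_dvd')
  then have "int p ^ ?k dvd a * d + c * b" by simp
  then have k: "?k \<le> ?v (a * d + c * b)"
    using nz assms by (intro multiplicity_geI) auto
  have "min (rat_pval p x) (rat_pval p y) \<le> rat_pval p (x + y)"
    unfolding xy unfolding ab(2) cd(2)
    using k a ab(1) cd(1) assms nz
    by (auto simp: rat_pval_frac prime_elem_multiplicity_mult_distrib[OF P]
        simp del: of_int_mult of_int_add)
  then have "rat_pval p x \<le> rat_pval p (x + y) \<or> rat_pval p y \<le> rat_pval p (x + y)" by linarith
  then show ?thesis using False prime_gt_1_nat[OF assms]
    by (auto simp: rat_pabs_def le_max_iff_disj power_int_increasing)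
qed

lemma rat_pabs_add: "prime p \<Longrightarrow> rat_pabs p (x + y) \<le> rat_pabs p x + rat_pabs p y"
  using rat_pabs_add_max[of p x y] rat_pabs_nonneg[of p x] rat_pabs_nonneg[of p y]
  by linarith

lemma rat_pabs_diff_sym: "rat_pabs p (x - y) = rat_pabs p (y - x)"
  using rat_pabs_minus[of p "x - y"] by simp

lemma rat_pabs_abs_diff: "prime p \<Longrightarrow> \<bar>rat_pabs p x - rat_pabs p y\<bar> \<le> rat_pabs p (x - y)"
  using rat_pabs_add[of p "x - y" y] rat_pabs_add[of p "y - x" x] rat_pabs_diff_sym[of p x y]
  by simp

lemma rat_pabs_inverse: "prime p \<Longrightarrow> rat_pabs p (inverse x) = inverse (rat_pabs p x)"
  using rat_pabs_mult[of p x "inverse x"] rat_pabs_pos[of p x]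
  by (cases "x = 0") (auto simp: field_simps)


section \<open>The field of $p$-adic numbers\<close>

definition pcauchy :: "nat \<Rightarrow> (nat \<Rightarrow> rat) \<Rightarrow> bool" where
  "pcauchy p X \<longleftrightarrow> (\<forall>e>0. \<exists>N. \<forall>m\<ge>N. \<forall>n\<ge>N. rat_pabs p (X m - X n) < e)"

definition pnull :: "nat \<Rightarrow> (nat \<Rightarrow> rat) \<Rightarrow> bool" where
  "pnull p X \<longleftrightarrow> (\<lambda>n. rat_pabs p (X n)) \<longlonglongrightarrow> 0"

lemma pnull_zero [simp]: "pnull p (\<lambda>n. 0)"
  by (simp add: pnull_def)

lemma pnull_add: "prime p \<Longrightarrow> pnull p X \<Longrightarrow> pnull p Y \<Longrightarrow> pnull p (\<lambda>n. X n + Y n)"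
  unfolding pnull_def
  by (rule tendsto_sandwich[OF _ _ tendsto_const
        tendsto_add[of "\<lambda>n. rat_pabs p (X n)" 0 _ "\<lambda>n. rat_pabs p (Y n)" 0, simplified]])
     (auto intro!: always_eventually rat_pabs_add)

lemma pnull_minus: "pnull p X \<Longrightarrow> pnull p (\<lambda>n. - X n)"
  by (simp add: pnull_def)

lemma pcauchy_const [simp]: "pcauchy p (\<lambda>n. c)"
  by (simp add: pcauchy_def)

lemma pcauchy_minus: "pcauchy p X \<Longrightarrow> pcauchy p (\<lambda>n. - X n)"
  using rat_pabs_diff_sym by (simp add: pcauchy_def)

lemma pcauchy_add:
  assumes p: "prime p" and "pcauchy p X" "pcauchy p Y"
  shows "pcauchy p (\<lambda>n. X n + Y n)"
  unfolding pcauchy_def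
proof (intro allI impI)
  fix e :: real assume e: "e > 0"
  obtain M where M: "\<And>m n. m \<ge> M \<Longrightarrow> n \<ge> M \<Longrightarrow> rat_pabs p (X m - X n) < e"
    using assms(2) e unfolding pcauchy_def by blast
  obtain N where N: "\<And>m n. m \<ge> N \<Longrightarrow> n \<ge> N \<Longrightarrow> rat_pabs p (Y m - Y n) < e"
    using assms(3) e unfolding pcauchy_def by blast
  have "rat_pabs p (X m + Y m - (X n + Y n)) < e" if "m \<ge> max M N" "n \<ge> max M N" for m n
    using rat_pabs_add_max[OF p, of "X m - X n" "Y m - Y n"] M[of m n] N[of m n] that
    by (simp add: algebra_simps)
  then show "\<exists>N. \<forall>m\<ge>N. \<forall>n\<ge>N. rat_pabs p (X m + Y m - (X n + Y n)) < e" by blast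
qed

lemma pcauchy_convergent:
  assumes p: "prime p" and "pcauchy p X"
  shows "convergent (\<lambda>n. rat_pabs p (X n))"
proof (rule Cauchy_convergent, rule CauchyI)
  fix e :: real assume "e > 0"
  then obtain M where M: "\<And>m n. m \<ge> M \<Longrightarrow> n \<ge> M \<Longrightarrow> rat_pabs p (X m - X n) < e"
    using assms(2) unfolding pcauchy_def by blast
  show "\<exists>M. \<forall>m\<ge>M. \<forall>n\<ge>M. norm (rat_pabs p (X m) - rat_pabs p (X n)) < e"
    using M rat_pabs_abs_diff[OF p] by (metis real_norm_def order.strict_trans1)
qed

lemma pcauchy_bounded:
  assumes p: "prime p" and "pcauchy p X"
  shows "\<exists>B>0. \<forall>n. rat_pabs p (X n) \<le> B"
proof -
  obtain K where "K > 0" "\<forall>n. norm (rat_pabs p (X n)) \<le> K"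
    using convergent_imp_Bseq[OF pcauchy_convergent[OF assms]] by (rule BseqE)
  then show ?thesis by auto
qed

lemma pnull_mult_bounded:
  assumes p: "prime p" and X: "\<And>n. rat_pabs p (X n) \<le> B" and Y: "pnull p Y"
  shows "pnull p (\<lambda>n. X n * Y n)"
  unfolding pnull_def
proof (rule tendsto_sandwich[OF _ _ tendsto_const])
  show "(\<lambda>n. B * rat_pabs p (Y n)) \<longlonglongrightarrow> 0"
    using tendsto_mult_left[OF Y[unfolded pnull_def], of B] by simp
qed (use X in \<open>auto simp: rat_pabs_mult[OF p] intro!: always_eventually mult_right_mono\<close>)

lemma pcauchy_mult:
  assumes p: "prime p" and X: "pcauchy p X" and Y: "pcauchy p Y"
  shows "pcauchy p (\<lambda>n. X n * Y n)"
  unfolding pcauchy_def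
proof (intro allI impI)
  fix e :: real assume e: "e > 0"
  obtain B where B: "B > 0" "\<And>n. rat_pabs p (X n) \<le> B" using pcauchy_bounded[OF p X] by blast
  obtain C where C: "C > 0" "\<And>n. rat_pabs p (Y n) \<le> C" using pcauchy_bounded[OF p Y] by blast
  have "e / C > 0" "e / B > 0" using e B C by auto
  obtain M where M: "\<And>m n. m \<ge> M \<Longrightarrow> n \<ge> M \<Longrightarrow> rat_pabs p (X m - X n) < e / C"
    using X \<open>e / C > 0\<close> unfolding pcauchy_def by blast
  obtain N where N: "\<And>m n. m \<ge> N \<Longrightarrow> n \<ge> N \<Longrightarrow> rat_pabs p (Y m - Y n) < e / B"
    using Y \<open>e / B > 0\<close> unfolding pcauchy_def by blast
  have "rat_pabs p (X m * Y m - X n * Y n) < e" if mn: "m \<ge> max M N" "n \<ge> max M N" for m n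
  proof -
    have "rat_pabs p (X m * (Y m - Y n)) \<le> B * rat_pabs p (Y m - Y n)"
      using B(2)[of m] by (auto simp: rat_pabs_mult[OF p] intro!: mult_right_mono)
    also have "\<dots> < e" using N[of m n] mn B(1) by (simp add: field_simps)
    finally have 1: "rat_pabs p (X m * (Y m - Y n)) < e" .
    have "rat_pabs p ((X m - X n) * Y n) \<le> rat_pabs p (X m - X n) * C"
      using C(2)[of n] by (auto simp: rat_pabs_mult[OF p] intro!: mult_left_mono)
    also have "\<dots> < e" using M[of m n] mn C(1) by (simp add: field_simps)
    finally have 2: "rat_pabs p ((X m - X n) * Y n) < e" .
    show ?thesis
      using rat_pabs_add_max[OF p, of "X m * (Y m - Y n)" "(X m - X n) * Y n"] 1 2
      by (simp add: algebra_simps)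
  qed
  then show "\<exists>N. \<forall>m\<ge>N. \<forall>n\<ge>N. rat_pabs p (X m * Y m - X n * Y n) < e" by blast
qed

lemma pcauchy_not_pnull:
  assumes p: "prime p" and X: "pcauchy p X" and "\<not> pnull p X"
  obtains c N where "c > 0" "\<And>n. n \<ge> N \<Longrightarrow> c < rat_pabs p (X n)"
proof -
  obtain L where L: "(\<lambda>n. rat_pabs p (X n)) \<longlonglongrightarrow> L"
    using pcauchy_convergent[OF p X] unfolding convergent_def by blast
  have "L \<ge> 0" by (rule LIMSEQ_le_const[OF L]) simp
  moreover have "L \<noteq> 0" using L assms(3) by (auto simp: pnull_def)
  ultimately have "L / 2 < L" "L / 2 > 0" by auto
  then show ?thesis using order_tendstoD(1)[OF L, of "L / 2"] that
    unfolding eventually_sequentially by blast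
qed

lemma pcauchy_inverse:
  assumes p: "prime p" and X: "pcauchy p X" and nX: "\<not> pnull p X"
  shows "pcauchy p (\<lambda>n. inverse (X n))"
  unfolding pcauchy_def
proof (intro allI impI)
  fix e :: real assume e: "e > 0"
  obtain c M where c: "c > 0" "\<And>n. n \<ge> M \<Longrightarrow> c < rat_pabs p (X n)"
    using pcauchy_not_pnull[OF p X nX] by blast
  have "e * c * c > 0" using e c by auto
  then obtain N where N: "\<And>m n. m \<ge> N \<Longrightarrow> n \<ge> N \<Longrightarrow> rat_pabs p (X m - X n) < e * c * c"
    using X unfolding pcauchy_def by blast
  have "rat_pabs p (inverse (X m) - inverse (X n)) < e" if mn: "m \<ge> max M N" "n \<ge> max M N" for m n
  proof -
    have cc: "c < rat_pabs p (X m)" "c < rat_pabs p (X n)" using c(2) mn by auto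
    then have nz: "X m \<noteq> 0" "X n \<noteq> 0" using c(1) by auto
    have "rat_pabs p (X m - X n) < e * (c * c)"
      using N[of m n] mn by (simp add: mult.assoc)
    also have "\<dots> \<le> e * (rat_pabs p (X m) * rat_pabs p (X n))"
      using cc c(1) e by (intro mult_left_mono mult_mono) auto
    finally have *: "rat_pabs p (X m - X n) < e * (rat_pabs p (X m) * rat_pabs p (X n))" .
    have "inverse (X m) - inverse (X n) = (X n - X m) * inverse (X m * X n)"
      using nz by (simp add: field_simps)
    then have "rat_pabs p (inverse (X m) - inverse (X n)) =
        rat_pabs p (X m - X n) / (rat_pabs p (X m) * rat_pabs p (X n))"
      using rat_pabs_diff_sym[of p "X m" "X n"]
      by (simp add: rat_pabs_mult[OF p] rat_pabs_inverse[OF p] divide_inverse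
          del: inverse_mult_distrib)
    also have "\<dots> < e" using * cc c(1) by (subst pos_divide_less_eq) auto
    finally show ?thesis .
  qed
  then show "\<exists>N. \<forall>m\<ge>N. \<forall>n\<ge>N. rat_pabs p (inverse (X m) - inverse (X n)) < e" by blast
qed

text \<open>
  The prime is carried by a type parameter: \<open>'p\<close> is any finite type with a prime number
  of elements, and $p = $ \<open>CARD('p)\<close>.
\<close>

class prime_card = finite +
  assumes prime_card: "prime (CARD('a))"

definition padicrel :: "'p::prime_card itself \<Rightarrow> (nat \<Rightarrow> rat) \<Rightarrow> (nat \<Rightarrow> rat) \<Rightarrow> bool" where
  "padicrel _ X Y \<longleftrightarrow>
     pcauchy CARD('p) X \<and> pcauchy CARD('p) Y \<and> pnull CARD('p) (\<lambda>n. X n - Y n)"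

lemma part_equivp_padicrel: "part_equivp (padicrel TYPE('p::prime_card))"
proof (rule part_equivpI)
  show "\<exists>x. padicrel TYPE('p) x x"
    by (rule exI[of _ "\<lambda>_. 0"]) (simp add: padicrel_def)
  show "symp (padicrel TYPE('p))"
    by (rule sympI) (simp add: padicrel_def pnull_def rat_pabs_diff_sym)
  show "transp (padicrel TYPE('p))"
  proof (rule transpI)
    fix X Y Z assume *: "padicrel TYPE('p) X Y" "padicrel TYPE('p) Y Z"
    then have "pnull CARD('p) (\<lambda>n. (X n - Y n) + (Y n - Z n))"
      unfolding padicrel_def by (intro pnull_add prime_card) auto
    with * show "padicrel TYPE('p) X Z" by (simp add: padicrel_def)
  qed
qed

text \<open>
  Equivalence classes of Cauchy sequences modulo null sequences. The parameter \<open>'p\<close> does not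
  occur in the type of the representatives, which \<^bold>\<open>quotient_type\<close> does not support; hence
  the explicit \<^bold>\<open>typedef\<close>.
\<close>

typedef ('p::prime_card) padic =
  "{C. \<exists>X. padicrel TYPE('p) X X \<and> C = Collect (padicrel TYPE('p) X)}"
proof -
  have "padicrel TYPE('p) (\<lambda>_. 0) (\<lambda>_. 0)" by (simp add: padicrel_def)
  then show ?thesis by blast
qed

definition abs_padic :: "(nat \<Rightarrow> rat) \<Rightarrow> 'p::prime_card padic" where
  "abs_padic X = Abs_padic (Collect (padicrel TYPE('p) X))"

definition rep_padic :: "'p::prime_card padic \<Rightarrow> nat \<Rightarrow> rat" where
  "rep_padic x = (SOME X. X \<in> Rep_padic x)"

definition cr_padic :: "(nat \<Rightarrow> rat) \<Rightarrow> 'p::prime_card padic \<Rightarrow> bool" where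
  "cr_padic X x \<longleftrightarrow> padicrel TYPE('p) X X \<and> abs_padic X = x"

lemma Quotient_padic:
  "Quotient (padicrel TYPE('p)) abs_padic rep_padic
     (cr_padic :: _ \<Rightarrow> 'p::prime_card padic \<Rightarrow> _)"
proof (rule Quotient3_to_Quotient)
  have Q: "quot_type (padicrel TYPE('p)) (Abs_padic :: _ \<Rightarrow> 'p padic) Rep_padic"
  proof
    fix x y :: "'p padic" and C
    show "part_equivp (padicrel TYPE('p))" by (rule part_equivp_padicrel)
    show "\<exists>X. padicrel TYPE('p) X X \<and> Rep_padic x = Collect (padicrel TYPE('p) X)"
      using Rep_padic[of x] by (rule CollectD)
    show "Abs_padic (Rep_padic x) = x" by (rule Rep_padic_inverse)
    show "Rep_padic (Abs_padic C :: 'p padic) = C"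
      if "\<exists>X. padicrel TYPE('p) X X \<and> C = Collect (padicrel TYPE('p) X)"
      using that by (intro Abs_padic_inverse CollectI)
    show "Rep_padic x = Rep_padic y \<longleftrightarrow> x = y" by (rule Rep_padic_inject)
  qed
  have "(abs_padic :: _ \<Rightarrow> 'p padic) = quot_type.abs (padicrel TYPE('p)) Abs_padic"
    by (rule ext) (simp only: abs_padic_def quot_type.abs_def[OF Q])
  moreover have "(rep_padic :: 'p padic \<Rightarrow> _) = quot_type.rep Rep_padic"
    by (rule ext) (simp only: rep_padic_def quot_type.rep_def[OF Q])
  ultimately show "Quotient3 (padicrel TYPE('p)) (abs_padic :: _ \<Rightarrow> 'p padic) rep_padic"
    using quot_type.Quotient[OF Q] by (simp only:)
  show "cr_padic \<equiv> \<lambda>X (x :: 'p padic). padicrel TYPE('p) X X \<and> abs_padic X = x"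
    by (rule eq_reflection, intro ext) (rule cr_padic_def)
qed

setup_lifting Quotient_padic

lemma padicrel_refl: "padicrel TYPE('p::prime_card) X X \<longleftrightarrow> pcauchy CARD('p) X"
  by (simp add: padicrel_def)

instantiation padic :: (prime_card) field
begin

lift_definition zero_padic :: "'a padic" is "\<lambda>n. 0"
  by (simp add: padicrel_def)

lift_definition one_padic :: "'a padic" is "\<lambda>n. 1"
  by (simp add: padicrel_def)

lift_definition plus_padic :: "'a padic \<Rightarrow> 'a padic \<Rightarrow> 'a padic" is "\<lambda>X Y n. X n + Y n"
  subgoal for X X' Y Y'
    using pnull_add[OF prime_card[where 'a='a], of "\<lambda>n. X n - X' n" "\<lambda>n. Y n - Y' n"]
    by (auto simp: padicrel_def pcauchy_add prime_card algebra_simps)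
  done

lift_definition uminus_padic :: "'a padic \<Rightarrow> 'a padic" is "\<lambda>X n. - X n"
  subgoal for X X'
    using pnull_minus[of "CARD('a)" "\<lambda>n. X n - X' n"]
    by (auto simp: padicrel_def pcauchy_minus algebra_simps)
  done

lift_definition times_padic :: "'a padic \<Rightarrow> 'a padic \<Rightarrow> 'a padic" is "\<lambda>X Y n. X n * Y n"
proof -
  fix X X' Y Y'
  assume *: "padicrel TYPE('a) X X'" "padicrel TYPE('a) Y Y'"
  have "pcauchy CARD('a) X" using * by (simp add: padicrel_def)
  then obtain B where B: "\<And>n. rat_pabs CARD('a) (X n) \<le> B"
    using pcauchy_bounded[OF prime_card, of X] by blast
  have "pcauchy CARD('a) Y'" using * by (simp add: padicrel_def)
  then obtain C where C: "\<And>n. rat_pabs CARD('a) (Y' n) \<le> C"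
    using pcauchy_bounded[OF prime_card, of Y'] by blast
  have "pnull CARD('a) (\<lambda>n. X n * (Y n - Y' n) + Y' n * (X n - X' n))"
    using B C * unfolding padicrel_def
    by (intro pnull_add pnull_mult_bounded prime_card) auto
  then have "pnull CARD('a) (\<lambda>n. X n * Y n - X' n * Y' n)" by (simp add: algebra_simps)
  with * show "padicrel TYPE('a) (\<lambda>n. X n * Y n) (\<lambda>n. X' n * Y' n)"
    by (auto simp: padicrel_def pcauchy_mult prime_card)
qed

lift_definition inverse_padic :: "'a padic \<Rightarrow> 'a padic"
  is "\<lambda>X. if pnull CARD('a) X then (\<lambda>n. 0) else (\<lambda>n. inverse (X n))"
proof -
  fix X Y
  assume *: "padicrel TYPE('a) X Y"
  then have X: "pcauchy CARD('a) X" and Y: "pcauchy CARD('a) Y"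
    and XY: "pnull CARD('a) (\<lambda>n. X n - Y n)"
    by (auto simp: padicrel_def)
  have iff: "pnull CARD('a) X \<longleftrightarrow> pnull CARD('a) Y"
    using pnull_add[OF prime_card XY, of Y] pnull_add[OF prime_card pnull_minus[OF XY], of X]
    by auto
  have "pnull CARD('a) (\<lambda>n. inverse (X n) - inverse (Y n))" if nX: "\<not> pnull CARD('a) X"
  proof -
    have nY: "\<not> pnull CARD('a) Y" using iff nX by simp
    obtain B where B: "\<And>n. rat_pabs CARD('a) (inverse (X n)) \<le> B"
      using pcauchy_bounded[OF prime_card pcauchy_inverse[OF prime_card X nX]] by blast
    obtain C where C: "\<And>n. rat_pabs CARD('a) (inverse (Y n)) \<le> C"
      using pcauchy_bounded[OF prime_card pcauchy_inverse[OF prime_card Y nY]] by blast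
    have 1: "pnull CARD('a) (\<lambda>n. inverse (X n) * (inverse (Y n) * - (X n - Y n)))"
      using B C XY by (intro pnull_mult_bounded[OF prime_card] pnull_minus)
    obtain c M where c: "c > 0" "\<And>n. n \<ge> M \<Longrightarrow> c < rat_pabs CARD('a) (X n)"
      using pcauchy_not_pnull[OF prime_card X nX] by blast
    obtain d N where d: "d > 0" "\<And>n. n \<ge> N \<Longrightarrow> d < rat_pabs CARD('a) (Y n)"
      using pcauchy_not_pnull[OF prime_card Y nY] by blast
    have "inverse (X n) * (inverse (Y n) * - (X n - Y n)) = inverse (X n) - inverse (Y n)"
      if "n \<ge> max M N" for n
    proof -
      have "X n \<noteq> 0" "Y n \<noteq> 0" using c d that by force+
      then show ?thesis by (simp add: field_simps)
    qed
    then have "\<forall>\<^sub>F n in sequentially.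
        rat_pabs CARD('a) (inverse (X n) * (inverse (Y n) * - (X n - Y n))) =
        rat_pabs CARD('a) (inverse (X n) - inverse (Y n))"
      by (intro eventually_sequentiallyI[of "max M N"]) (simp only:)
    from tendsto_cong[OF this] 1 show ?thesis unfolding pnull_def by simp
  qed
  then show "padicrel TYPE('a) (if pnull CARD('a) X then (\<lambda>n. 0) else (\<lambda>n. inverse (X n)))
     (if pnull CARD('a) Y then (\<lambda>n. 0) else (\<lambda>n. inverse (Y n)))"
    using iff X Y by (auto simp: padicrel_def pcauchy_inverse prime_card)
qed

definition "x - y = x + - y" for x y :: "'a padic"

definition "x div y = x * inverse y" for x y :: "'a padic"

instance
proof
  fix a b c :: "'a padic"
  show "a + b = b + a"
    by transfer (simp add: ac_simps padicrel_refl pcauchy_add prime_card)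
  show "(a + b) + c = a + (b + c)"
    by transfer (simp add: ac_simps padicrel_refl pcauchy_add prime_card)
  show "0 + a = a"
    by transfer (simp add: padicrel_refl)
  show "- a + a = 0"
    by transfer (simp add: padicrel_def)
  show "a - b = a + - b"
    by (rule minus_padic_def)
  show "(a * b) * c = a * (b * c)"
    by transfer (simp add: ac_simps padicrel_refl pcauchy_mult prime_card)
  show "a * b = b * a"
    by transfer (simp add: ac_simps padicrel_refl pcauchy_mult prime_card)
  show "1 * a = a"
    by transfer (simp add: padicrel_refl)
  show "(a + b) * c = a * c + b * c"
    by transfer (simp add: distrib_right padicrel_refl pcauchy_mult pcauchy_add prime_card)
  show "(0::'a padic) \<noteq> 1"
    by transfer (simp add: padicrel_def pnull_def LIMSEQ_const_iff)
  show "a \<noteq> 0 \<Longrightarrow> inverse a * a = 1"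
  proof (transfer, clarsimp simp: padicrel_refl)
    fix X assume X: "pcauchy CARD('a) X" and "\<not> padicrel TYPE('a) X (\<lambda>n. 0)"
    then have nX: "\<not> pnull CARD('a) X" by (simp add: padicrel_def)
    obtain c M where c: "c > 0" "\<And>n. n \<ge> M \<Longrightarrow> c < rat_pabs CARD('a) (X n)"
      using pcauchy_not_pnull[OF prime_card X nX] by blast
    have "rat_pabs CARD('a) (inverse (X n) * X n - 1) = 0" if "n \<ge> M" for n
    proof -
      have "X n \<noteq> 0" using c that by force
      then show ?thesis by simp
    qed
    then have "pnull CARD('a) (\<lambda>n. inverse (X n) * X n - 1)"
      unfolding pnull_def by (intro tendsto_eventually) (auto simp: eventually_sequentially)
    then show "(pnull CARD('a) X \<longrightarrow> padicrel TYPE('a) (\<lambda>n. 0) (\<lambda>n. 1)) \<and>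
        (\<not> pnull CARD('a) X \<longrightarrow> padicrel TYPE('a) (\<lambda>n. inverse (X n) * X n) (\<lambda>n. 1))"
      using nX X
      by (simp add: padicrel_def pcauchy_mult pcauchy_inverse prime_card)
  qed
  show "a div b = a * inverse b"
    by (rule divide_padic_def)
  show "inverse (0::'a padic) = 0"
    by transfer (simp add: padicrel_def)
qed

end

lift_definition padic_abs :: "'p::prime_card padic \<Rightarrow> real"
  is "\<lambda>X. lim (\<lambda>n. rat_pabs CARD('p) (X n))"
proof -
  fix X Y assume "padicrel TYPE('p) X Y"
  then have Y: "pcauchy CARD('p) Y" and XY: "(\<lambda>n. rat_pabs CARD('p) (X n - Y n)) \<longlonglongrightarrow> 0"
    by (simp_all add: padicrel_def pnull_def)
  obtain L where L: "(\<lambda>n. rat_pabs CARD('p) (Y n)) \<longlonglongrightarrow> L"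
    using pcauchy_convergent[OF prime_card Y] unfolding convergent_def by (rule exE)
  have "(\<lambda>n. rat_pabs CARD('p) (X n) - rat_pabs CARD('p) (Y n)) \<longlonglongrightarrow> 0"
    by (rule Lim_null_comparison[OF always_eventually XY]) (simp add: rat_pabs_abs_diff[OF prime_card])
  from tendsto_add[OF this L] have X: "(\<lambda>n. rat_pabs CARD('p) (X n)) \<longlonglongrightarrow> L" by simp
  show "lim (\<lambda>n. rat_pabs CARD('p) (X n)) = lim (\<lambda>n. rat_pabs CARD('p) (Y n))"
    by (simp only: limI[OF L] limI[OF X])
qed

lemma pcauchy_tendsto_lim:
  "prime p \<Longrightarrow> pcauchy p X \<Longrightarrow> (\<lambda>n. rat_pabs p (X n)) \<longlonglongrightarrow> lim (\<lambda>n. rat_pabs p (X n))"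
  using pcauchy_convergent[of p X] by (simp only: convergent_LIMSEQ_iff)

lemma padic_abs_eq_0_iff [simp]: "padic_abs x = 0 \<longleftrightarrow> x = 0"
proof (transfer, unfold padicrel_refl)
  fix X assume X: "pcauchy CARD('a) X"
  show "lim (\<lambda>n. rat_pabs CARD('a) (X n)) = 0 \<longleftrightarrow> padicrel TYPE('a) X (\<lambda>n. 0)"
  proof
    assume "lim (\<lambda>n. rat_pabs CARD('a) (X n)) = 0"
    then show "padicrel TYPE('a) X (\<lambda>n. 0)"
      using pcauchy_tendsto_lim[OF prime_card X] X by (simp add: padicrel_def pnull_def)
  next
    assume "padicrel TYPE('a) X (\<lambda>n. 0)"
    then have "(\<lambda>n. rat_pabs CARD('a) (X n)) \<longlonglongrightarrow> 0" by (simp add: padicrel_def pnull_def)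
    then show "lim (\<lambda>n. rat_pabs CARD('a) (X n)) = 0" by (rule limI)
  qed
qed

lemma padic_abs_0 [simp]: "padic_abs 0 = 0"
  by simp

lemma padic_abs_1 [simp]: "padic_abs (1 :: 'p::prime_card padic) = 1"
  by transfer simp

lemma padic_abs_nonneg [simp]: "padic_abs x \<ge> 0"
proof (transfer, unfold padicrel_refl)
  fix X assume X: "pcauchy CARD('a) X"
  show "lim (\<lambda>n. rat_pabs CARD('a) (X n)) \<ge> 0"
    by (rule LIMSEQ_le_const[OF pcauchy_tendsto_lim[OF prime_card X]]) simp
qed

lemma padic_abs_minus [simp]: "padic_abs (- x) = padic_abs x"
  by transfer simp

lemma padic_abs_mult: "padic_abs (x * y) = padic_abs x * padic_abs y"
proof (transfer, unfold padicrel_refl)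
  fix X Y assume X: "pcauchy CARD('a) X" and Y: "pcauchy CARD('a) Y"
  show "lim (\<lambda>n. rat_pabs CARD('a) (X n * Y n)) =
      lim (\<lambda>n. rat_pabs CARD('a) (X n)) * lim (\<lambda>n. rat_pabs CARD('a) (Y n))"
    using tendsto_mult[OF pcauchy_tendsto_lim[OF prime_card X] pcauchy_tendsto_lim[OF prime_card Y]]
    unfolding rat_pabs_mult[OF prime_card] by (rule limI)
qed

lemma padic_abs_add_max: "padic_abs (x + y) \<le> max (padic_abs x) (padic_abs y)"
proof (transfer, unfold padicrel_refl)
  fix X Y assume X: "pcauchy CARD('a) X" and Y: "pcauchy CARD('a) Y"
  show "lim (\<lambda>n. rat_pabs CARD('a) (X n + Y n)) \<le>
      max (lim (\<lambda>n. rat_pabs CARD('a) (X n))) (lim (\<lambda>n. rat_pabs CARD('a) (Y n)))"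
    by (rule LIMSEQ_le[OF pcauchy_tendsto_lim[OF prime_card pcauchy_add[OF prime_card X Y]]
          tendsto_max[OF pcauchy_tendsto_lim[OF prime_card X] pcauchy_tendsto_lim[OF prime_card Y]]])
       (auto intro: rat_pabs_add_max prime_card)
qed

lemma padic_abs_add: "padic_abs (x + y) \<le> padic_abs x + padic_abs y"
  using padic_abs_add_max[of x y] padic_abs_nonneg[of x] padic_abs_nonneg[of y] by linarith

lemma padic_of_nat: "(of_nat n :: 'p::prime_card padic) = abs_padic (\<lambda>_. of_nat n)"
proof (induction n)
  case 0
  show ?case by (simp only: of_nat_0 zero_padic.abs_eq)
next
  case (Suc n)
  have "(1 :: 'p padic) + abs_padic (\<lambda>_. of_nat n) = abs_padic (\<lambda>_. 1 + of_nat n)"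
    unfolding one_padic.abs_eq by (rule plus_padic.abs_eq) (simp_all only: padicrel_refl pcauchy_const)
  with Suc show ?case by (simp only: of_nat_Suc)
qed

lemma padic_abs_of_nat: "padic_abs (of_nat n :: 'p::prime_card padic) = rat_pabs CARD('p) (of_nat n)"
  unfolding padic_of_nat by (subst padic_abs.abs_eq) (simp_all only: padicrel_refl pcauchy_const limI[OF tendsto_const])

lemma padic_abs_prime:
  "padic_abs (of_nat CARD('p) :: 'p::prime_card padic) = 1 / real CARD('p)"
proof -
  have "rat_pval CARD('p) (of_int (int CARD('p)) / of_int 1) = 1"
    using prime_card[where 'a='p] by (subst rat_pval_frac) auto
  then show ?thesis
    by (simp add: padic_abs_of_nat rat_pabs_def power_int_minus inverse_eq_divide)
qed

instantiation padic :: (prime_card) metric_space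
begin

definition "dist x y = padic_abs (x - y)" for x y :: "'a padic"

definition "uniformity = (INF e\<in>{0<..}. principal {(x, y :: 'a padic). dist x y < e})"

definition "open U \<longleftrightarrow> (\<forall>x\<in>U. \<forall>\<^sub>F (x', y) in uniformity. x' = x \<longrightarrow> y \<in> U)"
  for U :: "'a padic set"

instance
proof
  fix x y z :: "'a padic"
  show "dist x y = 0 \<longleftrightarrow> x = y" by (simp add: dist_padic_def)
  show "dist x y \<le> dist x z + dist y z"
    using padic_abs_add[of "x - z" "z - y"] padic_abs_minus[of "y - z"]
    by (simp add: dist_padic_def)
qed (simp_all add: uniformity_padic_def open_padic_def)

end


section \<open>The space $\mathbb{Q}_p^d$\<close>

definition vec_padic_abs :: "'p::prime_card padic ^ 'd \<Rightarrow> real" where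
  "vec_padic_abs x = (MAX l. padic_abs (x $ l))"

definition padic_integer_vecs :: "('p::prime_card padic ^ 'd) set" where
  "padic_integer_vecs = {x. \<forall>l. padic_abs (x $ l) \<le> 1}"

definition normalized_haar :: "('p::prime_card padic ^ 'd) measure \<Rightarrow> bool" where
  "normalized_haar \<mu> \<longleftrightarrow>
     sets \<mu> = sets borel \<and>
     (\<forall>a. \<forall>E\<in>sets borel. emeasure \<mu> ((\<lambda>x. a + x) ` E) = emeasure \<mu> E) \<and>
     emeasure \<mu> padic_integer_vecs = 1"

definition padic_orthogonal :: "'p::prime_card padic ^ 'd ^ 'd \<Rightarrow> bool" where
  "padic_orthogonal U \<longleftrightarrow> (\<forall>x. vec_padic_abs (U *v x) = vec_padic_abs x)"

definition deformed_ultrametric ::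
  "('p::prime_card padic ^ 'd \<Rightarrow> 'p padic ^ 'd \<Rightarrow> real) \<Rightarrow> bool" where
  "deformed_ultrametric \<delta> \<longleftrightarrow>
     (\<exists>q U. (\<forall>l. 1 / real CARD('p) < q l \<and> q l \<le> 1) \<and> padic_orthogonal U \<and>
       (\<forall>x y. \<delta> x y = (MAX l. q l * padic_abs ((U *v x) $ l - (U *v y) $ l))))"

text \<open>
  Away from \<open>0\<close> the values of a deformed ultrametric form a discrete set, so closed and open
  balls of positive radius are the same sets.
\<close>

definition is_zero_ball :: "('v::zero \<Rightarrow> 'v \<Rightarrow> real) \<Rightarrow> 'v set \<Rightarrow> bool" where
  "is_zero_ball \<delta> B \<longleftrightarrow> (\<exists>r>0. B = {x. \<delta> 0 x \<le> r})"

definition maximal_zero_subball :: "('v::zero \<Rightarrow> 'v \<Rightarrow> real) \<Rightarrow> 'v set \<Rightarrow> 'v set \<Rightarrow> bool" where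
  "maximal_zero_subball \<delta> B C \<longleftrightarrow>
     is_zero_ball \<delta> C \<and> C \<subset> B \<and> \<not> (\<exists>C'. is_zero_ball \<delta> C' \<and> C \<subset> C' \<and> C' \<subset> B)"

definition is_dilation ::
  "('p::prime_card padic ^ 'd \<Rightarrow> 'p padic ^ 'd \<Rightarrow> real) \<Rightarrow> ('p padic ^ 'd \<Rightarrow> 'p padic ^ 'd) \<Rightarrow> bool"
where
  "is_dilation \<delta> f \<longleftrightarrow>
     Vector_Spaces.linear (*s) (*s) f \<and>
     (\<forall>B. is_zero_ball \<delta> B \<longrightarrow> maximal_zero_subball \<delta> B (f ` B))"


section \<open>Digits, the tile and the map between the two spaces\<close>

definition vec_of_int :: "int ^ 'd \<Rightarrow> 'a::ring_1 ^ 'd" where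
  "vec_of_int v = (\<chi> l. of_int (v $ l))"

text \<open>
  Integer powers with respect to the matrix product; the operation \<open>^\<close> on \<open>vec\<close> is componentwise.
\<close>

definition mat_powi :: "'a::semiring_1 ^ 'd ^ 'd \<Rightarrow> int \<Rightarrow> 'a ^ 'd ^ 'd" where
  "mat_powi A k =
     (if k \<ge> 0 then (((**) A) ^^ nat k) (mat 1) else (((**) (matrix_inv A)) ^^ nat (- k)) (mat 1))"

text \<open>
  Exactly $p$ integer vectors, meeting every class of $\mathbb{Z}_p^d / M\mathbb{Z}_p^d$.
\<close>

definition digit_set :: "'p::prime_card padic ^ 'd ^ 'd \<Rightarrow> (int ^ 'd) set \<Rightarrow> bool" where
  "digit_set M D \<longleftrightarrow>
     card D = CARD('p) \<and>
     (\<forall>x\<in>padic_integer_vecs. \<exists>n\<in>D. x - vec_of_int n \<in> (*v) M ` padic_integer_vecs)"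

definition tile :: "int ^ 'd ^ 'd \<Rightarrow> (int ^ 'd) set \<Rightarrow> (real ^ 'd) set" where
  "tile A D = {y. \<exists>x :: nat \<Rightarrow> int ^ 'd. (\<forall>i. x i \<in> D) \<and>
     (\<lambda>i. mat_powi (map_matrix of_int A) (- int i - 1) *v vec_of_int (x i)) sums y}"

text \<open>
  \<open>digit_map A D \<rho>\<close>: the prescription $\sum_{i\ge\gamma} A^i x_i \mapsto \sum_{i\ge\gamma} A^{-i-1} x_i$
  is a well-defined map, namely \<open>\<rho>\<close>. An element of $\mathbb{Q}_p^d$ has such an expansion for every
  sufficiently small $\gamma$, and all of them must yield the same, convergent, real series value.
\<close>

definition digit_map ::
  "int ^ 'd ^ 'd \<Rightarrow> (int ^ 'd) set \<Rightarrow> ('p::prime_card padic ^ 'd \<Rightarrow> real ^ 'd) \<Rightarrow> bool" where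
  "digit_map A D \<rho> \<longleftrightarrow>
     (\<forall>(\<gamma>::int) (x :: int \<Rightarrow> int ^ 'd) z. (\<forall>i. x i \<in> D) \<longrightarrow>
        (\<lambda>n. mat_powi (map_matrix of_int A) (\<gamma> + int n) *v vec_of_int (x (\<gamma> + int n))) sums z \<longrightarrow>
        (\<lambda>n. mat_powi (map_matrix of_int A) (- (\<gamma> + int n) - 1) *v vec_of_int (x (\<gamma> + int n)))
          sums \<rho> z)"

end

theory Submission
  imports Defs
begin

text \<open>
  Write \<open>M\<close> and \<open>B\<close> for $A$ acting on $\mathbb{Q}_p^d$ and on $\mathbb{R}^d$, $K$ for
  $\mathbb{Z}_p^d$ and $T$ for the tile. The map $\rho$ carries the coset of $M^kK$ whose elements
  have an expansion beginning with a fixed word of digits $w = (x_\gamma,\dots,x_{k-1})$ exactly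
  onto $B^{-k}(s + T)$, where $s = \sum_i A^{k-1-i}x_i$ is an integer vector. Such a coset has Haar
  measure $p^{-k}$, so three facts about the sets $B^{-k}(s+T)$ are what the theorem rests on.

  They have measure $p^{-k}$, because $|\det B| = p$. Indeed $\det A$ is a nonzero multiple of $p$
  by the hypothesis on $|\det A|_p$, so $|\det B|\ge p$; and $T$ is covered by the $p$ sets
  $B^{-1}(n + T)$ with $n$ a digit, so $1 \le p/|\det B|$ (\<open>abs_det_le_card_digits\<close>).

  Two of them that belong to different words of the same length overlap in a null set. Condition (B)
  says so as soon as the two integer vectors differ, and they do: $s$ determines its last digit
  modulo $AK$, then the one before, and so on (\<open>horner_inj\<close>). That distinct digits are incongruent
  modulo $AK$, on which the Haar measure of the cosets depends too, holds because $K/AK$ has at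
  least $p$ elements: the multiples $0,v,\dots,(p-1)v$ of any $v\in K\setminus AK$ are
  incongruent (\<open>digit_eqI\<close>).

  Every point of $B^{-k}(s+T)$ is attained, because every digit series converges $p$-adically. Here
  the completeness of $\mathbb{Q}_p$ enters, and the fact that the lattices $M^nK$ shrink to zero:
  they form a strictly decreasing chain of balls of the deformed ultrametric, which takes only
  finitely many values in an interval $(e,1]$ with $e > 0$ (\<open>dilation_shrinks\<close>).

  The passage from cosets to arbitrary sets goes through the inverse of $\rho$. Two distinct points
  are separated by cosets of some $M^kK$, so by the overlap property $\rho$ is injective off a countable
  union of null sets. A map which is injective up to a null set of values and has the right image
  measure on an intersection-stable generator preserves the measure of every set, since the inverse
  of the map pushes the target measure forward to a measure that agrees with the given one on the
  generator (\<open>emeasure_image_eq_from_generator\<close>).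
\<close>

section \<open>Lebesgue measure of linear images\<close>

lemma det_shear:
  fixes m n :: "'n::finite"
  assumes "m \<noteq> n"
  shows "det (matrix (\<lambda>v :: real ^ 'n. \<chi> i. if i = m then v $ m + v $ n else v $ i)) = 1"
proof -
  have "matrix (\<lambda>v :: real ^ 'n. \<chi> i. if i = m then v $ m + v $ n else v $ i)
      = (\<chi> k. if k = m then row m (mat 1) + 1 *s row n (mat 1) else row k (mat 1))"
    by (auto simp: vec_eq_iff matrix_def row_def mat_def axis_def)
  then show ?thesis
    using det_row_operation[OF assms, of "mat 1 :: real ^ 'n ^ 'n" 1] by simp
qed

text \<open>
  Translating the box so that its \<open>n\<close>-th lower bound becomes \<open>0\<close> only translates the image under the
  shear, which reduces the claim to \<open>measure_shear_interval\<close>.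
\<close>

lemma measure_shear_cbox:
  fixes a b :: "real ^ 'n"
  assumes "m \<noteq> n"
  shows "measure lebesgue ((\<lambda>x. \<chi> i. if i = m then x $ m + x $ n else x $ i) ` cbox a b)
    = measure lebesgue (cbox a b)"
proof (cases "cbox a b = {}")
  case False
  let ?h = "\<lambda>x :: real ^ 'n. \<chi> i. if i = m then x $ m + x $ n else x $ i"
  define v :: "real ^ 'n" where "v = axis n (- a $ n)"
  have h_add: "?h (v + x) = ?h v + ?h x" for x
    by (simp add: vec_eq_iff)
  have "measure lebesgue (?h ` cbox (v + a) (v + b)) = measure lebesgue (cbox (v + a) (v + b))"
  proof (rule measure_shear_interval[OF assms])
    show "cbox (v + a) (v + b) \<noteq> {}"
      using False by (metis cbox_translation image_is_empty)
    show "0 \<le> (v + a) $ n" by (simp add: v_def axis_def)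
  qed
  moreover have "?h ` cbox (v + a) (v + b) = (+) (?h v) ` ?h ` cbox a b"
    unfolding cbox_translation image_image h_add ..
  ultimately show ?thesis
    by (simp add: cbox_translation measure_translation)
qed simp

text \<open>
  The classical scaling of volume by a linear map, over an index type without an order. A linear map
  is a composition of elementary ones, and the determinant of a shear is found by reading the shear
  as a row operation on the identity matrix instead of as a triangular matrix.
\<close>

lemma lmeasurable_linear_image:
  fixes f :: "real ^ 'n \<Rightarrow> real ^ 'n"
  assumes "linear f" "S \<in> lmeasurable"
  shows "f ` S \<in> lmeasurable \<and> measure lebesgue (f ` S) = \<bar>det (matrix f)\<bar> * measure lebesgue S"
proof -
  let ?Q = "\<lambda>f S. f ` S \<in> lmeasurable \<and> measure lebesgue (f ` S) = \<bar>det (matrix f)\<bar> * measure lebesgue S"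
  have unimodular: "\<forall>S \<in> lmeasurable. ?Q h S"
    if "linear h" "\<bar>det (matrix h)\<bar> = 1"
      and box: "\<And>a b. measure lebesgue (h ` cbox a b) = measure lebesgue (cbox a b)"
    for h :: "real ^ 'n \<Rightarrow> real ^ 'n"
  proof
    fix S :: "(real ^ 'n) set" assume S: "S \<in> lmeasurable"
    have "h ` S \<in> lmeasurable \<and> 1 * measure lebesgue S = measure lebesgue (h ` S)"
      by (rule measure_linear_sufficient[OF that(1) S]) (simp add: box)
    then show "?Q h S" using that(2) by simp
  qed
  have "\<forall>S \<in> lmeasurable. ?Q f S"
  proof (rule induct_linear_elementary[OF \<open>linear f\<close>])
    fix f g :: "real ^ 'n \<Rightarrow> real ^ 'n"
    assume *: "linear f" "linear g" "\<forall>S \<in> lmeasurable. ?Q f S" "\<forall>S \<in> lmeasurable. ?Q g S"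
    show "\<forall>S \<in> lmeasurable. ?Q (f \<circ> g) S"
    proof
      fix S :: "(real ^ 'n) set" assume "S \<in> lmeasurable"
      with * have "?Q g S" "?Q f (g ` S)" by blast+
      then show "?Q (f \<circ> g) S"
        using * by (simp add: image_comp o_def matrix_compose[unfolded o_def] det_mul abs_mult)
    qed
  next
    fix f :: "real ^ 'n \<Rightarrow> real ^ 'n" and i
    assume lin: "linear f" and i: "\<And>x. f x $ i = 0"
    have "\<not> surj f"
    proof
      assume "surj f"
      then obtain x where "f x = axis i 1" by (metis surjD)
      with i[of x] show False by simp
    qed
    then have "\<not> inj f" using lin linear_injective_imp_surjective by blast
    then have "negligible (f ` S)" for S
      using negligible_linear_singular_image[OF lin] by blast
    moreover have "det (matrix f) = 0"
      using \<open>\<not> inj f\<close> det_nz_iff_inj[OF lin] by blast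
    ultimately show "\<forall>S \<in> lmeasurable. ?Q f S"
      by (simp add: negligible_iff_measure)
  next
    fix c :: "'n \<Rightarrow> real"
    have "matrix (\<lambda>x. \<chi> i. c i * x $ i) $ i $ j = (if i = j then c i else 0)" for i j
      by (simp add: matrix_def axis_def)
    then show "\<forall>S \<in> lmeasurable. ?Q (\<lambda>x. \<chi> i. c i * x $ i) S"
      by (simp add: measurable_stretch measure_stretch det_diagonal)
  next
    fix m n :: 'n
    assume "m \<noteq> n"
    define t where "t = Transposition.transpose m n"
    let ?h = "\<lambda>x :: real ^ 'n. \<chi> i. x $ t i"
    have t: "t permutes UNIV" "t (t i) = i" for i
      unfolding t_def by (auto intro: permutes_swap_id)
    have box: "?h ` cbox a b = cbox (?h a) (?h b)" for a b
    proof (intro equalityI subsetI)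
      fix y assume "y \<in> cbox (?h a) (?h b)"
      then have "?h y \<in> cbox a b" by (simp add: mem_box_cart) (metis t(2))
      then show "y \<in> ?h ` cbox a b" by (rule rev_image_eqI) (simp add: vec_eq_iff t(2))
    qed (auto simp: mem_box_cart)
    have "measure lebesgue (?h ` cbox a b) = measure lebesgue (cbox a b)" for a b :: "real ^ 'n"
    proof (cases "cbox a b = {}")
      case False
      then have "cbox (?h a) (?h b) \<noteq> {}" unfolding box[symmetric] by simp
      with False show ?thesis
        unfolding box using prod.permute[OF t(1), of "\<lambda>i. (b - a) $ i"]
        by (simp add: content_cbox_cart o_def)
    qed simp
    moreover have "matrix ?h = transpose (\<chi> i j. mat 1 $ i $ t j)"
      using t(2) by (auto simp: vec_eq_iff matrix_def transpose_def mat_def axis_def)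
    then have "\<bar>det (matrix ?h)\<bar> = 1"
      using t(1) by (simp add: det_permute_columns sign_def)
    moreover have "linear ?h" by (rule linearI) (simp_all add: vec_eq_iff)
    ultimately show "\<forall>S \<in> lmeasurable. ?Q (\<lambda>x. \<chi> i. x $ Transposition.transpose m n i) S"
      using unimodular[of ?h] unfolding t_def[symmetric] by blast
  next
    fix m n :: 'n
    assume "m \<noteq> n"
    let ?h = "\<lambda>x :: real ^ 'n. \<chi> i. if i = m then x $ m + x $ n else x $ i"
    show "\<forall>S \<in> lmeasurable. ?Q ?h S"
    proof (rule unimodular)
      show "linear ?h" by (rule linearI) (auto simp: vec_eq_iff algebra_simps)
      show "\<bar>det (matrix ?h)\<bar> = 1" unfolding det_shear[OF \<open>m \<noteq> n\<close>] by (rule abs_one)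
    qed (rule measure_shear_cbox[OF \<open>m \<noteq> n\<close>])
  qed
  with assms show ?thesis by blast
qed

section \<open>Values and completeness of the $p$-adic numbers\<close>

lemma padic_abs_diff_sym: "padic_abs (x - y) = padic_abs (y - x)"
  using padic_abs_minus[of "x - y"] by simp

lemma padic_card_gt_1: "1 < real CARD('p::prime_card)"
  using prime_gt_1_nat[OF prime_card[where 'a = 'p]] by simp

text \<open>
  The logarithm to base $p$ of the absolute value is a limit of integers, hence an integer.
\<close>

lemma padic_abs_values:
  fixes x :: "'p::prime_card padic"
  assumes "x \<noteq> 0"
  shows "\<exists>k::int. padic_abs x = real CARD('p) powi k"
  using assms
proof (transfer, unfold padicrel_refl)
  fix X assume X: "pcauchy CARD('p) X" and nz: "\<not> padicrel TYPE('p) X (\<lambda>n. 0)"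
  let ?p = "real CARD('p)"
  define L where "L = lim (\<lambda>n. rat_pabs CARD('p) (X n))"
  have lim: "(\<lambda>n. rat_pabs CARD('p) (X n)) \<longlonglongrightarrow> L"
    unfolding L_def by (rule pcauchy_tendsto_lim[OF prime_card X])
  have "\<not> pnull CARD('p) X"
    using nz X by (simp add: padicrel_def)
  then obtain c N where c: "c > 0" "\<And>n. n \<ge> N \<Longrightarrow> c < rat_pabs CARD('p) (X n)"
    using pcauchy_not_pnull[OF prime_card X] by blast
  have "c \<le> L"
    by (rule LIMSEQ_le_const[OF lim]) (use c(2) less_imp_le in blast)
  with c(1) have L: "L > 0" by simp
  have p: "?p > 1" by (rule padic_card_gt_1)
  have "(\<lambda>n. log ?p (rat_pabs CARD('p) (X n))) \<longlonglongrightarrow> log ?p L"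
    using p L by (intro tendsto_log tendsto_const lim) auto
  moreover have "log ?p (rat_pabs CARD('p) (X n)) \<in> \<int>" if "n \<ge> N" for n
  proof -
    have "X n \<noteq> 0" using c(1) c(2)[OF that] by auto
    then have "rat_pabs CARD('p) (X n) = ?p powr of_int (- rat_pval CARD('p) (X n))"
      using p powr_real_of_int'[of ?p "- rat_pval CARD('p) (X n)"] by (simp add: rat_pabs_def)
    then show ?thesis using p by simp
  qed
  then have "\<forall>\<^sub>F n in sequentially. log ?p (rat_pabs CARD('p) (X n)) \<in> (\<int> :: real set)"
    by (auto simp: eventually_sequentially)
  ultimately have "log ?p L \<in> \<int>"
    using closed_Ints[where 'a = real] by (metis Lim_in_closed_set sequentially_bot)
  then obtain k where "log ?p L = of_int k" by (auto elim: Ints_cases)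
  then have "L = ?p powr of_int k" using p L powr_log_cancel[of ?p L] by simp
  then show "\<exists>k::int. lim (\<lambda>n. rat_pabs CARD('p) (X n)) = ?p powi k"
    using p unfolding L_def[symmetric] by (auto simp: powr_real_of_int')
qed

lemma padic_abs_le_1_if_less:
  fixes x :: "'p::prime_card padic"
  assumes "padic_abs x < real CARD('p)"
  shows "padic_abs x \<le> 1"
proof (cases "x = 0")
  case False
  then obtain k where k: "padic_abs x = real CARD('p) powi k" using padic_abs_values by blast
  have "k \<le> 0"
  proof (rule ccontr)
    assume "\<not> k \<le> 0"
    then have "real CARD('p) powi 1 \<le> real CARD('p) powi k"
      using padic_card_gt_1[where 'p = 'p] by (intro power_int_increasing) auto
    with k assms show False by simp
  qed
  then have "real CARD('p) powi k \<le> real CARD('p) powi 0"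
    using padic_card_gt_1[where 'p = 'p] by (intro power_int_increasing) auto
  with k show ?thesis by simp
qed simp

lemma padic_abs_of_nat_le_1: "padic_abs (of_nat n :: 'p::prime_card padic) \<le> 1"
proof (induction n)
  case (Suc n)
  then show ?case using padic_abs_add_max[of 1 "of_nat n :: 'p padic"] by simp
qed simp

lemma padic_abs_of_int_abs:
  "padic_abs (of_int n :: 'p::prime_card padic) = padic_abs (of_nat (nat \<bar>n\<bar>) :: 'p padic)"
proof (cases "n \<ge> 0")
  case False
  then have "of_int n = - (of_nat (nat \<bar>n\<bar>) :: 'p padic)" by simp
  then show ?thesis by (simp only: padic_abs_minus)
qed simp

lemma padic_abs_of_int_le_1: "padic_abs (of_int n :: 'p::prime_card padic) \<le> 1"
  unfolding padic_abs_of_int_abs by (rule padic_abs_of_nat_le_1)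

lemma padic_abs_of_nat_eq_1:
  assumes "\<not> CARD('p) dvd n"
  shows "padic_abs (of_nat n :: 'p::prime_card padic) = 1"
proof -
  have "n \<noteq> 0" using assms by (metis dvd_0_right)
  have "\<not> int CARD('p) dvd int n" using assms by simp
  then have "rat_pval CARD('p) (of_int (int n) / of_int 1) = 0"
    using \<open>n \<noteq> 0\<close> prime_card[where 'a='p]
    by (subst rat_pval_frac) (auto simp: not_dvd_imp_multiplicity_0)
  then show ?thesis using \<open>n \<noteq> 0\<close> by (simp add: padic_abs_of_nat rat_pabs_def)
qed

lemma padic_abs_const_diff:
  "padic_abs (abs_padic (\<lambda>_. r) - abs_padic (\<lambda>_. s) :: 'p::prime_card padic) = rat_pabs CARD('p) (r - s)"
proof -
  have "- abs_padic (\<lambda>_. s) = (abs_padic (\<lambda>_. - s) :: 'p padic)"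
    by (rule uminus_padic.abs_eq) (simp add: padicrel_refl)
  then have "abs_padic (\<lambda>_. r) - abs_padic (\<lambda>_. s) = (abs_padic (\<lambda>_. r + - s) :: 'p padic)"
    using plus_padic.abs_eq[where 'a='p, of "\<lambda>_. r" "\<lambda>_. - s"]
    by (simp add: padicrel_refl diff_conv_add_uminus del: add_uminus_conv_diff)
  then show ?thesis
    using padic_abs.abs_eq[where 'p='p, of "\<lambda>_. r - s"] by (simp add: padicrel_refl)
qed

text \<open>
  Every $p$-adic number is the limit of the rationals in any Cauchy sequence that represents it.
  Completeness follows: replace the terms of a Cauchy sequence by ever closer rationals; these form
  a rational Cauchy sequence, and its class is the limit.
\<close>

lemma padic_tendsto_rep:
  fixes X :: "nat \<Rightarrow> rat"
  assumes "pcauchy CARD('p::prime_card) X"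
  shows "(\<lambda>n. abs_padic (\<lambda>_. X n)) \<longlonglongrightarrow> (abs_padic X :: 'p padic)"
proof (rule metric_LIMSEQ_I)
  fix e :: real assume e: "e > 0"
  then have "e / 2 > 0" by simp
  then obtain N where N: "\<And>m n. m \<ge> N \<Longrightarrow> n \<ge> N \<Longrightarrow> rat_pabs CARD('p) (X m - X n) < e / 2"
    using assms unfolding pcauchy_def by blast
  have "dist (abs_padic (\<lambda>_. X k)) (abs_padic X :: 'p padic) < e" if "k \<ge> N" for k
  proof -
    have diff: "pcauchy CARD('p) (\<lambda>n. X n + - X k)"
      using assms by (intro pcauchy_add prime_card pcauchy_const)
    have "- abs_padic (\<lambda>_. X k) = (abs_padic (\<lambda>_. - X k) :: 'p padic)"
      by (rule uminus_padic.abs_eq) (simp add: padicrel_refl)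
    then have "abs_padic X - abs_padic (\<lambda>_. X k) = (abs_padic (\<lambda>n. X n + - X k) :: 'p padic)"
      using plus_padic.abs_eq[where 'a='p, of X "\<lambda>_. - X k"] assms
      by (simp add: padicrel_refl diff_conv_add_uminus del: add_uminus_conv_diff)
    then have "padic_abs (abs_padic X - abs_padic (\<lambda>_. X k) :: 'p padic) =
        lim (\<lambda>n. rat_pabs CARD('p) (X n + - X k))"
      using padic_abs.abs_eq[where 'p='p, of "\<lambda>n. X n + - X k"] diff by (simp only: padicrel_refl)
    also have "\<dots> \<le> e / 2"
      by (rule LIMSEQ_le_const2[OF pcauchy_tendsto_lim[OF prime_card diff]])
         (use N that less_imp_le in \<open>auto intro!: exI[of _ N]\<close>)
    finally show ?thesis
      using e by (simp add: dist_padic_def padic_abs_diff_sym[of "abs_padic (\<lambda>_. X k)"])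
  qed
  then show "\<exists>N. \<forall>k\<ge>N. dist (abs_padic (\<lambda>_. X k)) (abs_padic X :: 'p padic) < e" by blast
qed

instance padic :: (prime_card) complete_space
proof
  fix x :: "nat \<Rightarrow> 'a padic"
  assume Cauchy: "Cauchy x"
  have "\<exists>r. dist (abs_padic (\<lambda>_. r)) (x n) < 1 / real (Suc n)" for n
  proof -
    obtain Y where Y: "pcauchy CARD('a) Y" "x n = abs_padic Y"
      using Quotient_rep_reflp[OF Quotient_padic] Quotient_abs_rep[OF Quotient_padic]
      unfolding padicrel_refl by metis
    have "1 / real (Suc n) > 0" by simp
    with padic_tendsto_rep[OF Y(1)] show ?thesis unfolding Y(2) by (meson metric_LIMSEQ_D order_refl)
  qed
  then obtain r where r: "\<And>n. dist (abs_padic (\<lambda>_. r n)) (x n) < 1 / real (Suc n)"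
    by metis
  let ?y = "\<lambda>n. abs_padic (\<lambda>_. r n) :: 'a padic"
  have close: "(\<lambda>n. dist (?y n) (x n)) \<longlonglongrightarrow> 0"
    by (rule Lim_null_comparison[OF _ LIMSEQ_Suc[OF lim_1_over_n]])
       (use r in \<open>auto intro!: always_eventually less_imp_le\<close>)
  have "pcauchy CARD('a) r"
    unfolding pcauchy_def
  proof (intro allI impI)
    fix e :: real assume e: "e > 0"
    obtain M where M: "\<And>m n. m \<ge> M \<Longrightarrow> n \<ge> M \<Longrightarrow> dist (x m) (x n) < e / 3"
      using Cauchy e metric_CauchyD[of x "e / 3"] by auto
    obtain N where N: "\<And>n. n \<ge> N \<Longrightarrow> dist (?y n) (x n) < e / 3"
      using metric_LIMSEQ_D[OF close, of "e / 3"] e by auto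
    have "rat_pabs CARD('a) (r m - r n) < e" if "m \<ge> max M N" "n \<ge> max M N" for m n
    proof -
      have "dist (?y m) (?y n) \<le> dist (?y m) (x m) + dist (x m) (x n) + dist (x n) (?y n)"
        by metric
      also have "\<dots> < e"
        using M[of m n] N[of m] N[of n] that by (simp add: dist_commute)
      finally show ?thesis by (simp add: dist_padic_def padic_abs_const_diff)
    qed
    then show "\<exists>N. \<forall>m\<ge>N. \<forall>n\<ge>N. rat_pabs CARD('a) (r m - r n) < e" by blast
  qed
  from iffD1[OF tendsto_dist_iff padic_tendsto_rep[OF this]]
  have "(\<lambda>n. dist (?y n) (abs_padic r)) \<longlonglongrightarrow> 0" .
  from tendsto_add[OF close this]
  have "(\<lambda>n. dist (?y n) (x n) + dist (?y n) (abs_padic r)) \<longlonglongrightarrow> 0" by simp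
  then have "(\<lambda>n. dist (x n) (abs_padic r)) \<longlonglongrightarrow> 0"
    by (rule Lim_null_comparison[rotated]) (auto intro!: always_eventually dist_triangle3)
  then have "x \<longlonglongrightarrow> abs_padic r" by (rule iffD2[OF tendsto_dist_iff])
  then show "convergent x" by (rule convergentI)
qed

section \<open>Integer powers of an invertible matrix\<close>

lemma matrix_inv_cancel:
  assumes "invertible (M :: 'a::semiring_1 ^ 'n ^ 'n)"
  shows "M ** matrix_inv M = mat 1" "matrix_inv M ** M = mat 1"
  using someI_ex[OF assms[unfolded invertible_def]] by (simp_all add: matrix_inv_def)

lemma mat_powi_0 [simp]: "mat_powi M 0 = mat 1"
  by (simp add: mat_powi_def)

lemma mat_powi_1 [simp]: "mat_powi M 1 = M"
  by (simp add: mat_powi_def)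

lemma mat_powi_plus_1:
  fixes M :: "'a::semiring_1 ^ 'n ^ 'n"
  assumes "invertible M"
  shows "mat_powi M (k + 1) = M ** mat_powi M k"
proof (cases "k \<ge> 0")
  case True
  then show ?thesis by (simp add: mat_powi_def nat_add_distrib)
next
  case False
  then have "nat (- k) = Suc (nat (- (k + 1)))" by simp
  then have "mat_powi M k = matrix_inv M ** mat_powi M (k + 1)"
    using False by (cases "k + 1 = 0") (auto simp: mat_powi_def)
  then show ?thesis
    by (simp add: matrix_mul_assoc matrix_inv_cancel[OF assms])
qed

lemma mat_powi_add:
  fixes M :: "'a::semiring_1 ^ 'n ^ 'n"
  assumes "invertible M"
  shows "mat_powi M (i + j) = mat_powi M i ** mat_powi M j"
proof (induction i rule: int_induct[where k = 0])
  case (step1 i)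
  then show ?case
    using mat_powi_plus_1[OF assms, of "i + j"] mat_powi_plus_1[OF assms, of i]
    by (simp add: algebra_simps matrix_mul_assoc)
next
  case (step2 i)
  have "M ** mat_powi M (i - 1 + j) = M ** (mat_powi M (i - 1) ** mat_powi M j)"
    using step2 mat_powi_plus_1[OF assms, of "i - 1 + j"] mat_powi_plus_1[OF assms, of "i - 1"]
    by (simp add: algebra_simps matrix_mul_assoc)
  then have "matrix_inv M ** (M ** mat_powi M (i - 1 + j)) =
      matrix_inv M ** (M ** (mat_powi M (i - 1) ** mat_powi M j))" by simp
  then show ?case
    unfolding matrix_mul_assoc matrix_inv_cancel[OF assms] by simp
qed simp

lemma mat_powi_mult_vec:
  fixes M :: "'a::semiring_1 ^ 'n ^ 'n"
  assumes "invertible M"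
  shows "mat_powi M i *v (mat_powi M j *v x) = mat_powi M (i + j) *v x"
  by (simp add: mat_powi_add[OF assms] matrix_vector_mul_assoc)

lemma mat_powi_nat_mult_vec:
  fixes M :: "'a::semiring_1 ^ 'n ^ 'n"
  assumes "invertible M"
  shows "mat_powi M (int n) *v x = ((*v) M ^^ n) x"
proof (induction n)
  case (Suc n)
  have "mat_powi M (int (Suc n)) = M ** mat_powi M (int n)"
    using mat_powi_plus_1[OF assms, of "int n"] by (simp add: add.commute)
  then show ?case using Suc by (simp add: matrix_vector_mul_assoc[symmetric])
qed simp

lemma det_mat_powi:
  fixes M :: "'a::field ^ 'n ^ 'n"
  assumes "invertible M"
  shows "det (mat_powi M k) = det M powi k"
proof (induction k rule: int_induct[where k = 0])
  case (step1 i)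
  have "det M \<noteq> 0" using assms invertible_det_nz by blast
  then show ?case
    using step1 by (simp add: mat_powi_plus_1[OF assms] det_mul power_int_add)
next
  case (step2 i)
  have nz: "det M \<noteq> 0" using assms invertible_det_nz by blast
  have "det M * det (mat_powi M (i - 1)) = det M * det M powi (i - 1)"
    using step2 mat_powi_plus_1[OF assms, of "i - 1"] power_int_add[of "det M" 1 "i - 1"] nz
    by (simp add: det_mul[symmetric])
  with nz show ?case by simp
qed simp

section \<open>The maximum norm on $\mathbb{Q}_p^d$\<close>

lemma vec_padic_abs_le_iff: "vec_padic_abs x \<le> e \<longleftrightarrow> (\<forall>l. padic_abs (x $ l) \<le> e)"
  unfolding vec_padic_abs_def by (subst Max_le_iff) auto

lemma vec_padic_abs_nonneg [simp]: "0 \<le> vec_padic_abs x"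
  using vec_padic_abs_le_iff[of x "vec_padic_abs x"] padic_abs_nonneg order_trans by blast

lemma padic_abs_le_vec_padic_abs: "padic_abs (x $ l) \<le> vec_padic_abs x"
  using vec_padic_abs_le_iff by blast

lemma padic_integer_vecs_iff: "x \<in> padic_integer_vecs \<longleftrightarrow> vec_padic_abs x \<le> 1"
  by (simp add: padic_integer_vecs_def vec_padic_abs_le_iff)

lemma vec_padic_abs_add_le:
  assumes "vec_padic_abs x \<le> e" "vec_padic_abs y \<le> e"
  shows "vec_padic_abs (x + y) \<le> e"
  using assms padic_abs_add_max order_trans unfolding vec_padic_abs_le_iff
  by (metis max.bounded_iff vector_add_component)

lemma vec_padic_abs_smult: "vec_padic_abs (c *s x) = padic_abs c * vec_padic_abs x"
  unfolding vec_padic_abs_def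
  using mono_Max_commute[of "\<lambda>y. padic_abs c * y" "range (\<lambda>l. padic_abs (x $ l))"]
  by (simp add: padic_abs_mult image_image mono_def mult_left_mono)

lemma padic_abs_sum_le:
  assumes "\<And>i. i \<in> A \<Longrightarrow> padic_abs (f i) \<le> e" "0 \<le> e"
  shows "padic_abs (\<Sum>i\<in>A. f i) \<le> e"
  using assms(1)
proof (induction A rule: infinite_finite_induct)
  case (insert i A)
  then show ?case using padic_abs_add_max[of "f i" "sum f A"] by fastforce
qed (use \<open>0 \<le> e\<close> in simp_all)

lemma vec_padic_abs_matrix_bound:
  fixes N :: "'p::prime_card padic ^ 'd ^ 'd"
  obtains C where "C > 0" "\<And>x. vec_padic_abs (N *v x) \<le> C * vec_padic_abs x"
proof
  define C where "C = 1 + (\<Sum>i\<in>UNIV. \<Sum>j\<in>UNIV. padic_abs (N $ i $ j))"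
  show C: "C > 0" unfolding C_def by (intro add_pos_nonneg sum_nonneg) auto
  have entry: "padic_abs (N $ i $ j) \<le> C" for i j
  proof -
    have "padic_abs (N $ i $ j) \<le> (\<Sum>j\<in>UNIV. padic_abs (N $ i $ j))"
      by (rule member_le_sum) auto
    also have "\<dots> \<le> (\<Sum>i\<in>UNIV. \<Sum>j\<in>UNIV. padic_abs (N $ i $ j))"
      by (rule member_le_sum) (auto intro: sum_nonneg)
    finally show ?thesis by (simp add: C_def)
  qed
  show "vec_padic_abs (N *v x) \<le> C * vec_padic_abs x" for x
    unfolding vec_padic_abs_le_iff[of "N *v x"]
    using C entry padic_abs_le_vec_padic_abs[of x]
    by (auto intro!: padic_abs_sum_le mult_mono simp: matrix_vector_mult_def padic_abs_mult)
qed

lemma vec_padic_abs_le_dist: "vec_padic_abs (x - y) \<le> dist x y"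
  unfolding vec_padic_abs_le_iff
  using dist_vec_nth_le[of x _ y] by (simp add: dist_padic_def)

lemma dist_le_vec_padic_abs:
  "dist x y \<le> real CARD('d) * vec_padic_abs (x - y :: 'p::prime_card padic ^ 'd)"
proof -
  have "dist x y \<le> (\<Sum>l\<in>UNIV. dist (x $ l) (y $ l))"
    unfolding dist_vec_def by (rule L2_set_le_sum) simp
  also have "\<dots> \<le> (\<Sum>l\<in>(UNIV :: 'd set). vec_padic_abs (x - y))"
    using padic_abs_le_vec_padic_abs[of "x - y"] by (intro sum_mono) (simp add: dist_padic_def)
  finally show ?thesis by simp
qed

lemma vec_of_int_in_padic_integer_vecs: "vec_of_int n \<in> padic_integer_vecs"
  by (simp add: padic_integer_vecs_def vec_of_int_def padic_abs_of_int_le_1)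

section \<open>Deformed ultrametrics and dilations\<close>

lemma deformed_ultrametric_zero:
  fixes \<delta> :: "'p::prime_card padic ^ 'd \<Rightarrow> 'p padic ^ 'd \<Rightarrow> real"
  assumes "deformed_ultrametric \<delta>"
  obtains q :: "'d \<Rightarrow> real" and U :: "'p padic ^ 'd ^ 'd"
  where "\<And>l. 1 / real CARD('p) < q l" "\<And>l. q l \<le> 1"
    "\<And>x. vec_padic_abs (U *v x) = vec_padic_abs x"
    "\<And>x. \<delta> 0 x = (MAX l. q l * padic_abs ((U *v x) $ l))"
proof -
  obtain q :: "'d \<Rightarrow> real" and U :: "'p padic ^ 'd ^ 'd"
    where q: "\<And>l. 1 / real CARD('p) < q l \<and> q l \<le> 1"
    and U: "\<And>x. vec_padic_abs (U *v x) = vec_padic_abs x"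
    and \<delta>: "\<And>x y. \<delta> x y = (MAX l. q l * padic_abs ((U *v x) $ l - (U *v y) $ l))"
    using assms unfolding deformed_ultrametric_def padic_orthogonal_def by blast
  have "\<delta> 0 x = (MAX l. q l * padic_abs ((U *v x) $ l))" for x
    unfolding \<delta> by simp
  with q U show ?thesis using that by blast
qed

lemma deformed_ultrametric_le:
  fixes \<delta> :: "'p::prime_card padic ^ 'd \<Rightarrow> 'p padic ^ 'd \<Rightarrow> real"
  assumes "deformed_ultrametric \<delta>"
  shows "\<delta> 0 x \<le> vec_padic_abs x"
proof -
  obtain q :: "'d \<Rightarrow> real" and U :: "'p padic ^ 'd ^ 'd"
    where q: "\<And>l. 1 / real CARD('p) < q l" "\<And>l. q l \<le> 1"
    and U: "\<And>x. vec_padic_abs (U *v x) = vec_padic_abs x"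
    and \<delta>: "\<And>x. \<delta> 0 x = (MAX l. q l * padic_abs ((U *v x) $ l))"
    by (rule deformed_ultrametric_zero[OF assms]) blast
  have "q l * padic_abs ((U *v x) $ l) \<le> vec_padic_abs x" for l
    using mult_right_mono[OF q(2)[of l] padic_abs_nonneg[of "(U *v x) $ l"]]
      padic_abs_le_vec_padic_abs[of "U *v x" l] by (simp add: U)
  then show ?thesis unfolding \<delta> by (subst Max_le_iff) auto
qed

lemma padic_abs_less_deformed:
  fixes \<delta> :: "'p::prime_card padic ^ 'd \<Rightarrow> 'p padic ^ 'd \<Rightarrow> real"
  assumes "deformed_ultrametric \<delta>" "\<delta> 0 x \<le> e" "0 < e"
  shows "padic_abs (x $ l) < real CARD('p) * e"
proof -
  have p: "real CARD('p) > 1" by (rule padic_card_gt_1)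
  obtain q :: "'d \<Rightarrow> real" and U :: "'p padic ^ 'd ^ 'd"
    where q: "\<And>l. 1 / real CARD('p) < q l" "\<And>l. q l \<le> 1"
    and U: "\<And>x. vec_padic_abs (U *v x) = vec_padic_abs x"
    and \<delta>: "\<And>x. \<delta> 0 x = (MAX l. q l * padic_abs ((U *v x) $ l))"
    by (rule deformed_ultrametric_zero[OF assms(1)]) blast
  have "padic_abs ((U *v x) $ l) < real CARD('p) * e" for l
  proof (cases "(U *v x) $ l = 0")
    case False
    then have "padic_abs ((U *v x) $ l) > 0"
      using padic_abs_nonneg padic_abs_eq_0_iff by (metis less_eq_real_def)
    then have "padic_abs ((U *v x) $ l) / real CARD('p) < q l * padic_abs ((U *v x) $ l)"
      using mult_strict_right_mono[OF q(1)[of l]] by simp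
    also have "\<dots> \<le> \<delta> 0 x" unfolding \<delta> by (rule Max_ge) auto
    also have "\<dots> \<le> e" by (rule assms(2))
    finally show ?thesis using p by (simp add: field_simps)
  qed (use assms p in simp)
  then have "vec_padic_abs (U *v x) < real CARD('p) * e"
    unfolding vec_padic_abs_def by (subst Max_less_iff) auto
  then show ?thesis
    using padic_abs_le_vec_padic_abs[of x l] by (simp add: U)
qed

text \<open>
  As $U$ preserves the maximum norm and the weights exceed $1/p$, a vector at distance at most $1$
  from zero has norm less than $p$; and a norm is zero or a power of $p$, hence at most $1$.
\<close>

lemma padic_integer_vecs_deformed_ball:
  fixes \<delta> :: "'p::prime_card padic ^ 'd \<Rightarrow> 'p padic ^ 'd \<Rightarrow> real"
  assumes "deformed_ultrametric \<delta>"
  shows "padic_integer_vecs = {x. \<delta> 0 x \<le> 1}"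
proof (intro equalityI subsetI)
  fix x :: "'p padic ^ 'd" assume "x \<in> padic_integer_vecs"
  then show "x \<in> {x. \<delta> 0 x \<le> 1}"
    using deformed_ultrametric_le[OF assms, of x] by (simp add: padic_integer_vecs_iff)
next
  fix x assume "x \<in> {x. \<delta> 0 x \<le> 1}"
  then have "padic_abs (x $ l) < real CARD('p)" for l
    using padic_abs_less_deformed[OF assms, of x 1] by simp
  then show "x \<in> padic_integer_vecs"
    by (auto simp: padic_integer_vecs_def intro: padic_abs_le_1_if_less)
qed

lemma power_int_less_imp_less: "a < b" if "x powi a < x powi b" "1 \<le> x" for x :: real
  using power_int_increasing[of b a x] that by linarith

text \<open>
  A nonzero value is one of the finitely many weights times a power of $p$, and the bounds on the
  value confine the exponent.
\<close>

lemma finite_deformed_values: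
  fixes \<delta> :: "'p::prime_card padic ^ 'd \<Rightarrow> 'p padic ^ 'd \<Rightarrow> real"
  assumes "deformed_ultrametric \<delta>" "0 < e"
  shows "finite {v \<in> range (\<delta> 0). e < v \<and> v \<le> 1}"
proof -
  let ?p = "real CARD('p)"
  have p: "?p > 1" by (rule padic_card_gt_1)
  obtain q :: "'d \<Rightarrow> real" and U :: "'p padic ^ 'd ^ 'd"
    where q: "\<And>l. 1 / ?p < q l" "\<And>l. q l \<le> 1"
    and U: "\<And>x. vec_padic_abs (U *v x) = vec_padic_abs x"
    and \<delta>: "\<And>x. \<delta> 0 x = (MAX l. q l * padic_abs ((U *v x) $ l))"
    by (rule deformed_ultrametric_zero[OF assms(1)]) blast
  obtain N where N: "(1 / ?p) ^ N < e"
    using real_arch_pow_inv[of e "1 / ?p"] assms(2) p by auto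
  have "v \<in> (\<lambda>(l, k). q l * ?p powi k) ` (UNIV \<times> {- int N..0})"
    if v: "v \<in> range (\<delta> 0)" "e < v" "v \<le> 1" for v
  proof -
    obtain x where x: "v = \<delta> 0 x" using v(1) by blast
    have "v \<in> range (\<lambda>l. q l * padic_abs ((U *v x) $ l))"
      unfolding x \<delta> by (rule Max_in) auto
    then obtain l where l: "v = q l * padic_abs ((U *v x) $ l)" by blast
    then have "(U *v x) $ l \<noteq> 0" using v(2) assms(2) by auto
    then obtain k where k: "padic_abs ((U *v x) $ l) = ?p powi k" using padic_abs_values by blast
    have pos: "?p powi k > 0" using p by simp
    have "?p powi k \<ge> v" unfolding l k using q(2)[of l] pos by simp
    then have "?p powi (- int N) < ?p powi k"
      using N v(2) by (simp add: power_int_minus power_one_over inverse_eq_divide)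
    then have lower: "- int N < k" by (rule power_int_less_imp_less) (use p in simp)
    have "?p powi k / ?p < v" unfolding l k using mult_strict_right_mono[OF q(1)[of l] pos] by simp
    also have "\<dots> \<le> 1" by (rule v(3))
    finally have "?p powi k < ?p powi 1" using p by (simp add: field_simps)
    then have "k < 1" by (rule power_int_less_imp_less) (use p in simp)
    with lower show ?thesis unfolding l k by (intro image_eqI[of _ _ "(l, k)"]) auto
  qed
  then have "{v \<in> range (\<delta> 0). e < v \<and> v \<le> 1} \<subseteq> (\<lambda>(l, k). q l * ?p powi k) ` (UNIV \<times> {- int N..0})"
    by blast
  then show ?thesis by (rule finite_subset) simp
qed

text \<open>
  The images of $\mathbb{Z}_p^d$ under the powers of a dilation are balls, each strictly inside the
  one before. If none of them were small, then points chosen in the successive differences would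
  have infinitely many distinct distances from zero in $(e/p,1]$, against
  \<open>finite_deformed_values\<close>.
\<close>

lemma dilation_shrinks:
  fixes M :: "'p::prime_card padic ^ 'd ^ 'd"
  assumes metric: "deformed_ultrametric \<delta>" and dilation: "is_dilation \<delta> ((*v) M)"
    and "0 < e"
  shows "\<exists>n. \<forall>x \<in> ((*v) M ^^ n) ` padic_integer_vecs. vec_padic_abs x \<le> e"
proof (rule ccontr)
  assume large: "\<not> ?thesis"
  let ?W = "\<lambda>n. ((*v) M ^^ n) ` padic_integer_vecs"
  let ?e = "e / real CARD('p)"
  have p: "real CARD('p) > 1" by (rule padic_card_gt_1)
  have W_Suc: "?W (Suc n) = (*v) M ` ?W n" for n by (simp add: image_comp)
  have ball: "is_zero_ball \<delta> (?W n)" for n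
  proof (induction n)
    case 0
    then show ?case
      using padic_integer_vecs_deformed_ball[OF metric] zero_less_one
      unfolding is_zero_ball_def by (auto simp del: zero_less_one)
  next
    case (Suc n)
    then show ?case
      using dilation unfolding W_Suc is_dilation_def maximal_zero_subball_def by blast
  qed
  have strict: "?W (Suc n) \<subset> ?W n" for n
    using ball[of n] dilation unfolding W_Suc is_dilation_def maximal_zero_subball_def by blast
  obtain r where r: "\<And>n. ?W n = {x. \<delta> 0 x \<le> r n}"
    using ball unfolding is_zero_ball_def by metis
  have r_lower: "?e < r n" for n
  proof -
    obtain x where x: "x \<in> ?W n" "\<not> vec_padic_abs x \<le> e" using large by blast
    have "\<not> \<delta> 0 x \<le> ?e"
      using x(2) padic_abs_less_deformed[OF metric, of x ?e] assms(3) p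
      by (auto simp: vec_padic_abs_le_iff less_imp_le)
    with x(1) show ?thesis unfolding r by simp
  qed
  have "\<exists>x. x \<in> ?W n \<and> x \<notin> ?W (Suc n)" for n using strict[of n] by blast
  then obtain x where x: "\<And>n. x n \<in> ?W n" "\<And>n. x n \<notin> ?W (Suc n)" by metis
  have dec: "\<delta> 0 (x (Suc n)) < \<delta> 0 (x n)" for n
    using x(1)[of "Suc n"] x(2)[of n] unfolding r by simp
  then have "strict_mono (\<lambda>n. - \<delta> 0 (x n))" by (simp add: strict_mono_Suc_iff)
  then have inj: "inj (\<lambda>n. \<delta> 0 (x n))"
    using strict_mono_eq by (fastforce simp: inj_def)
  have "x n \<in> padic_integer_vecs" for n
  proof -
    have "?W n \<subseteq> ?W 0"
      using lift_Suc_antimono_le[of ?W 0 n] strict by (simp add: less_imp_le)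
    then show ?thesis using x(1)[of n] by auto
  qed
  then have "\<delta> 0 (x n) \<le> 1" for n unfolding padic_integer_vecs_deformed_ball[OF metric] by simp
  moreover have "?e < \<delta> 0 (x n)" for n
    using x(2)[of n] r_lower[of "Suc n"] unfolding r by simp
  ultimately have "range (\<lambda>n. \<delta> 0 (x n)) \<subseteq> {v \<in> range (\<delta> 0). ?e < v \<and> v \<le> 1}"
    by auto
  then have "finite (range (\<lambda>n. \<delta> 0 (x n)))"
    by (rule finite_subset) (use finite_deformed_values[OF metric, of ?e] assms(3) p in simp)
  then show False using inj finite_imageD infinite_UNIV_nat by blast
qed

lemma dilation_padic_integer_vecs:
  assumes "deformed_ultrametric \<delta>" "is_dilation \<delta> f"
  shows "f ` padic_integer_vecs \<subset> padic_integer_vecs"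
proof -
  have "is_zero_ball \<delta> padic_integer_vecs"
    unfolding is_zero_ball_def padic_integer_vecs_deformed_ball[OF assms(1)]
    by (rule exI[of _ 1]) simp
  then show ?thesis using assms(2) unfolding is_dilation_def maximal_zero_subball_def by blast
qed

section \<open>The chain of lattices $A^k\mathbb{Z}_p^d$\<close>

text \<open>
  What remains of the dilation hypothesis once the metric is forgotten: $M$ maps $\mathbb{Z}_p^d$
  properly into itself and its powers shrink $\mathbb{Z}_p^d$ to zero. All topological and
  measure-theoretic statements about $\mathbb{Q}_p^d$ are reduced to the lattices
  $M^k\mathbb{Z}_p^d$, which are $\mathbb{Z}_p$-modules and a base of neighbourhoods of zero.
\<close>

locale padic_digit_system =
  fixes M :: "'p::prime_card padic ^ 'd ^ 'd" and D :: "(int ^ 'd) set"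
  assumes invertible: "invertible M"
    and proper: "(*v) M ` padic_integer_vecs \<subset> padic_integer_vecs"
    and shrinking: "0 < e \<Longrightarrow> \<exists>n. \<forall>x \<in> ((*v) M ^^ n) ` padic_integer_vecs. vec_padic_abs x \<le> e"
    and digits: "digit_set M D"
begin

definition lattice :: "int \<Rightarrow> ('p padic ^ 'd) set" where
  "lattice k = (*v) (mat_powi M k) ` padic_integer_vecs"

abbreviation shifted_digit :: "int \<Rightarrow> int ^ 'd \<Rightarrow> 'p padic ^ 'd" where
  "shifted_digit k n \<equiv> mat_powi M k *v vec_of_int n"

lemma lattice_0: "lattice 0 = padic_integer_vecs"
  by (simp add: lattice_def)

lemma mem_lattice_iff: "x \<in> lattice k \<longleftrightarrow> mat_powi M (- k) *v x \<in> padic_integer_vecs"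
proof
  assume "x \<in> lattice k"
  then show "mat_powi M (- k) *v x \<in> padic_integer_vecs"
    by (auto simp: lattice_def mat_powi_mult_vec[OF invertible])
next
  assume "mat_powi M (- k) *v x \<in> padic_integer_vecs"
  moreover have "x = mat_powi M k *v (mat_powi M (- k) *v x)"
    by (simp add: mat_powi_mult_vec[OF invertible])
  ultimately show "x \<in> lattice k" unfolding lattice_def by blast
qed

lemma mat_powi_mem_lattice_iff: "mat_powi M j *v x \<in> lattice (j + k) \<longleftrightarrow> x \<in> lattice k"
  by (simp add: mem_lattice_iff mat_powi_mult_vec[OF invertible])

lemma lattice_add: "x \<in> lattice k \<Longrightarrow> y \<in> lattice k \<Longrightarrow> x + y \<in> lattice k"
  by (simp add: mem_lattice_iff matrix_vector_right_distrib padic_integer_vecs_iff vec_padic_abs_add_le)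

lemma lattice_smult: "x \<in> lattice k \<Longrightarrow> padic_abs c \<le> 1 \<Longrightarrow> c *s x \<in> lattice k"
  by (simp add: mem_lattice_iff vec.scale padic_integer_vecs_iff vec_padic_abs_smult mult_le_one)

lemma lattice_minus: "x \<in> lattice k \<Longrightarrow> - x \<in> lattice k"
  using lattice_smult[of x k "- 1"] by simp

lemma lattice_diff: "x \<in> lattice k \<Longrightarrow> y \<in> lattice k \<Longrightarrow> x - y \<in> lattice k"
  using lattice_add[OF _ lattice_minus] by fastforce

lemma lattice_zero [simp]: "0 \<in> lattice k"
  by (simp add: mem_lattice_iff padic_integer_vecs_def)

lemma lattice_diff_commute: "x - y \<in> lattice k \<longleftrightarrow> y - x \<in> lattice k"
  using lattice_minus by (metis minus_diff_eq)

lemma lattice_antimono: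
  assumes "k \<le> l" shows "lattice l \<subseteq> lattice k"
proof -
  have next_subset: "lattice (k + 1) \<subseteq> lattice k" for k
  proof
    fix x assume "x \<in> lattice (k + 1)"
    then obtain y where y: "y \<in> padic_integer_vecs" "x = mat_powi M (k + 1) *v y"
      unfolding lattice_def by blast
    have "x = mat_powi M k *v (M *v y)"
      using y mat_powi_mult_vec[OF invertible, of k 1 y] by simp
    then show "x \<in> lattice k" using y(1) proper unfolding lattice_def by blast
  qed
  show ?thesis using assms
  proof (induction l rule: int_ge_induct)
    case (step l)
    then show ?case using next_subset by blast
  qed simp
qed

lemma digit_in_lattice_0: "vec_of_int n \<in> lattice 0"
  unfolding lattice_0 by (rule vec_of_int_in_padic_integer_vecs)

lemma shifted_digit_in_lattice: "shifted_digit k n \<in> lattice k"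
  unfolding lattice_def by (rule imageI[OF vec_of_int_in_padic_integer_vecs])

lemma lattice_small:
  assumes "0 < e" shows "\<exists>k. \<forall>x\<in>lattice k. vec_padic_abs x \<le> e"
  using shrinking[OF assms] unfolding mat_powi_nat_mult_vec[OF invertible, symmetric] lattice_def
  by (metis (no_types, lifting))

lemma lattice_small_dist:
  assumes "0 < e" shows "\<exists>k. \<forall>x y. x - y \<in> lattice k \<longrightarrow> dist x y < e"
proof -
  define e' where "e' = e / (2 * real CARD('d))"
  have "e' > 0" using assms by (simp add: e'_def)
  then obtain k where k: "\<And>x. x \<in> lattice k \<Longrightarrow> vec_padic_abs x \<le> e'"
    using lattice_small by blast
  have "dist x y < e" if "x - y \<in> lattice k" for x y
  proof -
    have "dist x y \<le> real CARD('d) * vec_padic_abs (x - y)" by (rule dist_le_vec_padic_abs)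
    also have "\<dots> \<le> real CARD('d) * e'" using k[OF that] by (intro mult_left_mono) auto
    also have "\<dots> < e" using assms by (simp add: e'_def)
    finally show ?thesis .
  qed
  then show ?thesis by blast
qed

lemma lattice_contains_box: "\<exists>e>0. \<forall>x. vec_padic_abs x \<le> e \<longrightarrow> x \<in> lattice k"
proof -
  obtain C where C: "C > 0" "\<And>x. vec_padic_abs (mat_powi M (- k) *v x) \<le> C * vec_padic_abs x"
    using vec_padic_abs_matrix_bound by blast
  have "x \<in> lattice k" if "vec_padic_abs x \<le> 1 / C" for x
    using C(2)[of x] that C(1) by (simp add: mem_lattice_iff padic_integer_vecs_iff field_simps)
  then show ?thesis using C(1) by (intro exI[of _ "1 / C"]) auto
qed

text \<open>
  Some $p^Nx$ is integral, and a power of $M$ maps the integral vectors into $p^N\mathbb{Z}_p^d$;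
  by linearity the same power maps $x$ into $\mathbb{Z}_p^d$.
\<close>

lemma lattice_exhaust: "\<exists>k. \<forall>l\<le>k. x \<in> lattice l"
proof -
  let ?p = "of_nat CARD('p) :: 'p padic"
  obtain N where N: "vec_padic_abs x < real CARD('p) ^ N"
    using real_arch_pow[OF padic_card_gt_1] by blast
  have p: "real CARD('p) > 1" "?p \<noteq> 0"
    using padic_card_gt_1[where 'p = 'p] padic_abs_prime[where 'p = 'p] padic_abs_eq_0_iff[of ?p] by auto
  have abs_power: "padic_abs (?p ^ N) = (1 / real CARD('p)) ^ N"
    by (induction N) (simp_all add: padic_abs_mult padic_abs_prime)
  define y where "y = (?p ^ N) *s x"
  have y: "y \<in> padic_integer_vecs"
    unfolding padic_integer_vecs_iff y_def vec_padic_abs_smult abs_power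
    using N p(1) by (simp add: field_simps)
  obtain k where k: "\<forall>z\<in>lattice k. vec_padic_abs z \<le> (1 / real CARD('p)) ^ N"
    using lattice_small[of "(1 / real CARD('p)) ^ N"] p(1) by auto
  have "mat_powi M k *v y = (?p ^ N) *s (mat_powi M k *v x)"
    unfolding y_def by (rule vec.scale)
  moreover have "vec_padic_abs (mat_powi M k *v y) \<le> (1 / real CARD('p)) ^ N"
    using k y unfolding lattice_def by blast
  ultimately have "x \<in> lattice (- k)"
    using p(1) by (simp add: mem_lattice_iff padic_integer_vecs_iff vec_padic_abs_smult abs_power)
  then show ?thesis using lattice_antimono by blast
qed

lemma tendsto_lattice_iff:
  "S \<longlonglongrightarrow> z \<longleftrightarrow> (\<forall>k. \<forall>\<^sub>F n in sequentially. S n - z \<in> lattice k)"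
proof
  assume S: "S \<longlonglongrightarrow> z"
  show "\<forall>k. \<forall>\<^sub>F n in sequentially. S n - z \<in> lattice k"
  proof
    fix k
    obtain e where e: "e > 0" "\<And>x. vec_padic_abs x \<le> e \<Longrightarrow> x \<in> lattice k"
      using lattice_contains_box by blast
    show "\<forall>\<^sub>F n in sequentially. S n - z \<in> lattice k"
      using tendstoD[OF S e(1)]
      by eventually_elim (use e(2) vec_padic_abs_le_dist order_trans less_imp_le in metis)
  qed
next
  assume S: "\<forall>k. \<forall>\<^sub>F n in sequentially. S n - z \<in> lattice k"
  show "S \<longlonglongrightarrow> z"
  proof (rule tendstoI)
    fix e :: real assume "e > 0"
    then obtain k where "\<And>x y. x - y \<in> lattice k \<Longrightarrow> dist x y < e"
      using lattice_small_dist by blast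
    then have "S n - z \<in> lattice k \<Longrightarrow> dist (S n) z < e" for n by blast
    with spec[OF S, of k] show "\<forall>\<^sub>F n in sequentially. dist (S n) z < e"
      by (rule eventually_mono)
  qed
qed

lemma open_lattice_coset: "open ((+) a ` lattice k)"
proof (rule openI)
  fix x assume x: "x \<in> (+) a ` lattice k"
  obtain e where e: "e > 0" "\<And>x. vec_padic_abs x \<le> e \<Longrightarrow> x \<in> lattice k"
    using lattice_contains_box by blast
  have "y \<in> (+) a ` lattice k" if "dist x y < e" for y
  proof -
    have "vec_padic_abs (y - x) \<le> e"
      using that vec_padic_abs_le_dist[of y x] by (simp add: dist_commute)
    then have "(y - x) + (x - a) \<in> lattice k" using x e(2) by (intro lattice_add) auto
    then show ?thesis by (intro image_eqI[of _ _ "y - a"]) auto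
  qed
  then show "\<exists>e>0. ball x e \<subseteq> (+) a ` lattice k"
    using e(1) by (intro exI[of _ e]) auto
qed

lemma open_contains_lattice_coset:
  assumes "open S" "x \<in> S"
  shows "\<exists>k. (+) x ` lattice k \<subseteq> S"
proof -
  obtain e where e: "e > 0" "ball x e \<subseteq> S" using assms openE by blast
  obtain k where k: "\<And>x y. x - y \<in> lattice k \<Longrightarrow> dist x y < e"
    using lattice_small_dist[OF e(1)] by blast
  have "x + y \<in> S" if "y \<in> lattice k" for y
    using k[of "x + y" x] that e(2) by (auto simp: dist_commute)
  then show ?thesis by blast
qed

section \<open>Digit expansions and cells\<close>

lemma finite_digits: "finite D" and card_digits: "card D = CARD('p)"
proof -
  show "card D = CARD('p)" using digits by (simp add: digit_set_def)
  then show "finite D" by (metis card.infinite zero_less_card_finite less_irrefl)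
qed

lemma digit_exists:
  assumes "x \<in> lattice k"
  shows "\<exists>n\<in>D. x - shifted_digit k n \<in> lattice (k + 1)"
proof -
  have "mat_powi M (- k) *v x \<in> padic_integer_vecs" using assms by (simp add: mem_lattice_iff)
  then obtain n where n: "n \<in> D" "mat_powi M (- k) *v x - vec_of_int n \<in> (*v) M ` padic_integer_vecs"
    using digits unfolding digit_set_def by blast
  then have "mat_powi M (- k) *v x - vec_of_int n \<in> lattice 1"
    by (simp add: lattice_def)
  then have "mat_powi M k *v (mat_powi M (- k) *v x - vec_of_int n) \<in> lattice (k + 1)"
    by (simp only: mat_powi_mem_lattice_iff)
  then have "x - shifted_digit k n \<in> lattice (k + 1)"
    by (simp add: matrix_vector_mult_diff_distrib mat_powi_mult_vec[OF invertible])
  with n(1) show ?thesis ..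
qed

text \<open>
  For $v \in \mathbb{Z}_p^d$ outside $M\mathbb{Z}_p^d$ the multiples $0, v, \dots, (p-1)v$ are
  pairwise incongruent, because the difference of two coefficients is a unit of $\mathbb{Z}_p$. Each
  class is represented by a digit, so the $p$ digits are matched one to one with these $p$ multiples.
\<close>

lemma digit_eqI:
  assumes "n \<in> D" "n' \<in> D" "vec_of_int n - vec_of_int n' \<in> lattice 1"
  shows "n = n'"
proof -
  have "lattice 1 \<subset> lattice 0" using proper by (simp add: lattice_def)
  then obtain v where v: "v \<in> lattice 0" "v \<notin> lattice 1" by blast
  let ?v = "\<lambda>i. (of_nat i :: 'p padic) *s v"
  have le: "i = j" if less: "j < CARD('p)" "i \<le> j" and ij: "?v j - ?v i \<in> lattice 1" for i j
  proof (rule ccontr)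
    let ?c = "of_nat (j - i) :: 'p padic"
    assume "i \<noteq> j"
    then have "\<not> CARD('p) dvd j - i" using less by (auto dest!: dvd_imp_le)
    then have c: "padic_abs ?c = 1" by (rule padic_abs_of_nat_eq_1)
    then have "?c \<noteq> 0" by auto
    then have "padic_abs (inverse ?c) \<le> 1"
      using padic_abs_mult[of "inverse ?c" ?c] c by simp
    moreover have "?c *s v \<in> lattice 1"
      using ij less by (simp add: vec.scale_left_diff_distrib)
    ultimately have "inverse ?c *s (?c *s v) \<in> lattice 1" using lattice_smult by blast
    then show False using v(2) \<open>?c \<noteq> 0\<close> by (simp add: vector_smult_assoc)
  qed
  have multiples: "i = j"
    if less: "i < CARD('p)" "j < CARD('p)" and ij: "?v i - ?v j \<in> lattice 1" for i j
    using le[of j i] le[of i j] that lattice_diff_commute[of "?v i" "?v j"] by (cases "i \<le> j") auto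
  have "\<exists>n\<in>D. ?v i - vec_of_int n \<in> lattice 1" for i
    using digit_exists[OF lattice_smult[OF v(1) padic_abs_of_nat_le_1], of i] by simp
  then obtain g where g: "\<And>i. g i \<in> D" "\<And>i. ?v i - vec_of_int (g i) \<in> lattice 1"
    by metis
  have cong: "i = j"
    if "i < CARD('p)" "j < CARD('p)" "vec_of_int (g i) - vec_of_int (g j) \<in> lattice 1" for i j
  proof -
    have "(?v i - vec_of_int (g i)) + (vec_of_int (g i) - vec_of_int (g j))
        - (?v j - vec_of_int (g j)) \<in> lattice 1"
      by (rule lattice_diff[OF lattice_add[OF g(2) that(3)] g(2)])
    then show ?thesis using multiples that by simp
  qed
  then have "inj_on g {..<CARD('p)}" by (auto simp: inj_on_def)
  then have "g ` {..<CARD('p)} = D"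
    using g(1) finite_digits by (intro card_subset_eq) (auto simp: card_image card_digits)
  then obtain i j where "i < CARD('p)" "n = g i" "j < CARD('p)" "n' = g j"
    using assms(1,2) by blast
  then show ?thesis using cong assms(3) by blast
qed

lemma lattice_sum: "(\<And>i. i \<in> A \<Longrightarrow> f i \<in> lattice k) \<Longrightarrow> sum f A \<in> lattice k"
  by (induction A rule: infinite_finite_induct) (auto intro: lattice_add)

definition digit_sum :: "int \<Rightarrow> (nat \<Rightarrow> int ^ 'd) \<Rightarrow> nat \<Rightarrow> 'p padic ^ 'd" where
  "digit_sum \<gamma> x m = (\<Sum>n<m. shifted_digit (\<gamma> + int n) (x n))"

lemma digit_sum_diff:
  assumes "m \<le> n" shows "digit_sum \<gamma> x n - digit_sum \<gamma> x m \<in> lattice (\<gamma> + int m)"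
proof -
  have "digit_sum \<gamma> x n - digit_sum \<gamma> x m = (\<Sum>i\<in>{m..<n}. shifted_digit (\<gamma> + int i) (x i))"
    using assms sum_diff_nat_ivl[of 0 m n "\<lambda>i. shifted_digit (\<gamma> + int i) (x i)"]
    by (simp add: digit_sum_def atLeast0LessThan)
  also have "\<dots> \<in> lattice (\<gamma> + int m)"
  proof (rule lattice_sum)
    fix i assume "i \<in> {m..<n}"
    then show "shifted_digit (\<gamma> + int i) (x i) \<in> lattice (\<gamma> + int m)"
      using shifted_digit_in_lattice lattice_antimono[of "\<gamma> + int m" "\<gamma> + int i"] by auto
  qed
  finally show ?thesis .
qed

text \<open>
  A tail of a digit series lies in a small lattice, so convergence to \<open>z\<close> can be read off from the
  individual remainders, and expansions can be cut and joined by algebra alone.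
\<close>

lemma digit_series_sums_iff:
  "(\<lambda>n. shifted_digit (\<gamma> + int n) (x n)) sums z \<longleftrightarrow>
    (\<forall>m. z - digit_sum \<gamma> x m \<in> lattice (\<gamma> + int m))"
proof
  assume "(\<lambda>n. shifted_digit (\<gamma> + int n) (x n)) sums z"
  then have lim: "digit_sum \<gamma> x \<longlonglongrightarrow> z" by (simp add: sums_def digit_sum_def[abs_def])
  show "\<forall>m. z - digit_sum \<gamma> x m \<in> lattice (\<gamma> + int m)"
  proof
    fix m
    obtain N where N: "\<And>n. n \<ge> N \<Longrightarrow> digit_sum \<gamma> x n - z \<in> lattice (\<gamma> + int m)"
      using lim unfolding tendsto_lattice_iff eventually_sequentially by blast
    from lattice_diff[OF digit_sum_diff[of m "max m N" \<gamma> x] N[of "max m N"]]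
    show "z - digit_sum \<gamma> x m \<in> lattice (\<gamma> + int m)" by simp
  qed
next
  assume *: "\<forall>m. z - digit_sum \<gamma> x m \<in> lattice (\<gamma> + int m)"
  have "\<forall>\<^sub>F n in sequentially. digit_sum \<gamma> x n - z \<in> lattice k" for k
  proof (rule eventually_sequentiallyI[of "nat (k - \<gamma>)"])
    fix n assume "nat (k - \<gamma>) \<le> n"
    then have "k \<le> \<gamma> + int n" by linarith
    with * show "digit_sum \<gamma> x n - z \<in> lattice k"
      using lattice_antimono lattice_diff_commute by blast
  qed
  then have "digit_sum \<gamma> x \<longlonglongrightarrow> z" by (simp add: tendsto_lattice_iff)
  then show "(\<lambda>n. shifted_digit (\<gamma> + int n) (x n)) sums z"
    by (simp add: sums_def digit_sum_def[abs_def])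
qed

lemma digit_series_converges:
  "\<exists>z. (\<lambda>n. shifted_digit (\<gamma> + int n) (x n)) sums z"
proof -
  have "Cauchy (digit_sum \<gamma> x)"
  proof (rule metric_CauchyI)
    fix e :: real assume "e > 0"
    then obtain k where k: "\<And>x y. x - y \<in> lattice k \<Longrightarrow> dist x y < e"
      using lattice_small_dist by blast
    define N where "N = nat (k - \<gamma>)"
    have close: "digit_sum \<gamma> x n - digit_sum \<gamma> x N \<in> lattice k" if "n \<ge> N" for n
    proof -
      have "k \<le> \<gamma> + int N" unfolding N_def by linarith
      then show ?thesis using digit_sum_diff[OF that] lattice_antimono by blast
    qed
    have "dist (digit_sum \<gamma> x m) (digit_sum \<gamma> x n) < e" if "m \<ge> N" "n \<ge> N" for m n
    proof -
      have "digit_sum \<gamma> x m - digit_sum \<gamma> x n \<in> lattice k"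
        using lattice_diff[OF close[OF that(1)] close[OF that(2)]] by simp
      then show ?thesis by (rule k)
    qed
    then show "\<exists>M. \<forall>m\<ge>M. \<forall>n\<ge>M. dist (digit_sum \<gamma> x m) (digit_sum \<gamma> x n) < e" by blast
  qed
  then obtain z where "digit_sum \<gamma> x \<longlonglongrightarrow> z"
    using Cauchy_convergent convergent_def by blast
  then show ?thesis unfolding sums_def digit_sum_def[abs_def] by blast
qed

lemma digit_expansion_exists:
  assumes "z \<in> lattice \<gamma>"
  shows "\<exists>x. (\<forall>n. x n \<in> D) \<and> (\<lambda>n. shifted_digit (\<gamma> + int n) (x n)) sums z"
proof -
  define d where "d k y = (SOME n. n \<in> D \<and> y - shifted_digit k n \<in> lattice (k + 1))" for k y
  have d: "d k y \<in> D \<and> y - shifted_digit k (d k y) \<in> lattice (k + 1)" if "y \<in> lattice k" for k y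
    unfolding d_def by (rule someI_ex) (use digit_exists[OF that] in blast)
  \<comment> \<open>\<open>r n\<close> is the remainder after \<open>n\<close> digits have been split off.\<close>
  define r where "r = rec_nat z (\<lambda>n y. y - shifted_digit (\<gamma> + int n) (d (\<gamma> + int n) y))"
  define x where "x n = d (\<gamma> + int n) (r n)" for n
  have r_Suc: "r (Suc n) = r n - shifted_digit (\<gamma> + int n) (x n)" for n
    by (simp add: r_def x_def)
  have r: "r n \<in> lattice (\<gamma> + int n)" for n
  proof (induction n)
    case 0
    then show ?case using assms by (simp add: r_def)
  next
    case (Suc n)
    from d[OF this] show ?case unfolding r_Suc x_def by (simp add: algebra_simps)
  qed
  have "z - digit_sum \<gamma> x n = r n" for n
  proof (induction n)
    case (Suc n)
    then show ?case by (simp add: r_Suc digit_sum_def algebra_simps)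
  qed (simp add: r_def digit_sum_def)
  moreover have "x n \<in> D" for n using d[OF r] by (simp add: x_def)
  ultimately show ?thesis using r unfolding digit_series_sums_iff by (intro exI[of _ x]) simp
qed

definition cell :: "int \<Rightarrow> (int ^ 'd) list \<Rightarrow> ('p padic ^ 'd) set" where
  "cell \<gamma> w = (+) (digit_sum \<gamma> ((!) w) (length w)) ` lattice (\<gamma> + int (length w))"

lemma mem_coset_iff: "z \<in> (+) a ` lattice k \<longleftrightarrow> z - a \<in> lattice k"
  by (force intro: image_eqI[of _ _ "z - a"])

lemma coset_eq:
  assumes "a - b \<in> lattice k" shows "(+) a ` lattice k = (+) b ` lattice k"
proof (rule set_eqI)
  fix z
  have "z - a \<in> lattice k \<longleftrightarrow> z - b \<in> lattice k"
    using lattice_add[OF assms, of "z - a"] lattice_diff[OF _ assms, of "z - b"] by auto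
  then show "z \<in> (+) a ` lattice k \<longleftrightarrow> z \<in> (+) b ` lattice k" by (simp only: mem_coset_iff)
qed

text \<open>
  The cell of \<open>w\<close> is defined as a coset, which is how it is measured; here it is the set of sums of
  the digit series that begin with \<open>w\<close>, which is how the digit map sees it.
\<close>

lemma mem_cell_iff_expansion:
  assumes "w \<in> lists D"
  shows "z \<in> cell \<gamma> w \<longleftrightarrow> (\<exists>x. (\<forall>n. x n \<in> D) \<and> (\<forall>n<length w. x n = w ! n) \<and>
    (\<lambda>n. shifted_digit (\<gamma> + int n) (x n)) sums z)"
proof
  let ?m = "length w"
  assume "z \<in> cell \<gamma> w"
  then have rem: "z - digit_sum \<gamma> ((!) w) ?m \<in> lattice (\<gamma> + int ?m)"
    by (simp only: cell_def mem_coset_iff)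
  then obtain y where y: "\<And>n. y n \<in> D"
    "(\<lambda>n. shifted_digit (\<gamma> + int ?m + int n) (y n)) sums (z - digit_sum \<gamma> ((!) w) ?m)"
    using digit_expansion_exists by blast
  define x where "x n = (if n < ?m then w ! n else y (n - ?m))" for n
  have prefix: "digit_sum \<gamma> x ?m = digit_sum \<gamma> ((!) w) ?m"
    by (simp add: digit_sum_def x_def)
  have "z - digit_sum \<gamma> x n \<in> lattice (\<gamma> + int n)" for n
  proof (cases "n \<le> ?m")
    case True
    then have "z - digit_sum \<gamma> x ?m \<in> lattice (\<gamma> + int n)"
      using rem lattice_antimono[of "\<gamma> + int n" "\<gamma> + int ?m"]
      by (auto simp: prefix)
    from lattice_add[OF this digit_sum_diff[OF True, of \<gamma> x]] show ?thesis by simp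
  next
    case False
    then obtain j where j: "n = ?m + j" using le_Suc_ex nat_le_linear by blast
    have "digit_sum \<gamma> x n = digit_sum \<gamma> x ?m + (\<Sum>i<j. shifted_digit (\<gamma> + int (?m + i)) (x (?m + i)))"
      unfolding digit_sum_def j by (induction j) (simp_all add: add.assoc)
    also have "\<dots> = digit_sum \<gamma> ((!) w) ?m + digit_sum (\<gamma> + int ?m) y j"
      unfolding prefix digit_sum_def[of "\<gamma> + int ?m"] by (simp add: x_def add.assoc)
    finally show ?thesis
      using y(2) unfolding digit_series_sums_iff j by (simp add: algebra_simps)
  qed
  moreover have "x n \<in> D" for n
    using y(1) assms by (auto simp: x_def in_lists_conv_set)
  moreover have "\<forall>n<?m. x n = w ! n" by (simp add: x_def)
  ultimately show "\<exists>x. (\<forall>n. x n \<in> D) \<and> (\<forall>n<?m. x n = w ! n) \<and>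
    (\<lambda>n. shifted_digit (\<gamma> + int n) (x n)) sums z"
    unfolding digit_series_sums_iff by (intro exI[of _ x]) blast
next
  let ?m = "length w"
  assume "\<exists>x. (\<forall>n. x n \<in> D) \<and> (\<forall>n<?m. x n = w ! n) \<and>
    (\<lambda>n. shifted_digit (\<gamma> + int n) (x n)) sums z"
  then obtain x where x: "\<forall>n<?m. x n = w ! n" "z - digit_sum \<gamma> x ?m \<in> lattice (\<gamma> + int ?m)"
    unfolding digit_series_sums_iff by blast
  then show "z \<in> cell \<gamma> w"
    unfolding cell_def mem_coset_iff by (simp add: digit_sum_def)
qed

text \<open>
  Only countably many cosets exist, and each has an image that is explicit, because each is a cell:
  take for \<open>w\<close> the first digits of an expansion of the translation vector.
\<close>

lemma coset_is_cell:
  obtains \<gamma> w where "w \<in> lists D" "\<gamma> + int (length w) = k" "(+) a ` lattice k = cell \<gamma> w"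
proof -
  obtain \<gamma> where \<gamma>: "\<gamma> \<le> k" "a \<in> lattice \<gamma>"
    using lattice_exhaust[of a] by (meson linear order_trans order_refl)
  obtain x where x: "\<And>n. x n \<in> D" "(\<lambda>n. shifted_digit (\<gamma> + int n) (x n)) sums a"
    using digit_expansion_exists[OF \<gamma>(2)] by blast
  define w where "w = map x [0..<nat (k - \<gamma>)]"
  have w: "w \<in> lists D" "\<gamma> + int (length w) = k" using x(1) \<gamma>(1) by (auto simp: w_def)
  have "a \<in> cell \<gamma> w"
    unfolding mem_cell_iff_expansion[OF w(1)] using x by (intro exI[of _ x]) (auto simp: w_def)
  then have "(+) a ` lattice k = cell \<gamma> w"
    unfolding cell_def mem_coset_iff w(2) by (rule coset_eq)
  with w show ?thesis by (rule that)
qed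

section \<open>Haar measure and Borel sets through cosets\<close>

text \<open>
  The empty set is included to make the family stable under intersection.
\<close>

definition cosets :: "('p padic ^ 'd) set set" where
  "cosets = insert {} {(+) a ` lattice k |a k. True}"

lemma countable_cosets: "countable cosets"
proof -
  have "cosets \<subseteq> insert {} (case_prod cell ` (UNIV \<times> lists D))"
  proof
    fix X assume "X \<in> cosets"
    then consider "X = {}" | a k where "X = (+) a ` lattice k" by (auto simp: cosets_def)
    then show "X \<in> insert {} (case_prod cell ` (UNIV \<times> lists D))"
    proof cases
      case 2
      then show ?thesis by (metis (mono_tags) coset_is_cell[of k a] SigmaI UNIV_I image_eqI insertCI prod.case)
    qed simp
  qed
  moreover have "countable (insert {} (case_prod cell ` (UNIV \<times> lists D)))"
    using finite_digits by (auto intro: countable_finite)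
  ultimately show ?thesis by (rule countable_subset)
qed

lemma Int_stable_cosets: "Int_stable cosets"
proof (rule Int_stableI)
  have nested: "(+) a ` lattice k \<inter> (+) b ` lattice l \<in> cosets" if "k \<le> l" for a b k l
  proof (cases "(+) a ` lattice k \<inter> (+) b ` lattice l = {}")
    case False
    then obtain z where z: "z - a \<in> lattice k" "z - b \<in> lattice l"
      by (metis (no_types) disjoint_iff mem_coset_iff)
    have "(+) a ` lattice k = (+) z ` lattice k" "(+) b ` lattice l = (+) z ` lattice l"
      using z lattice_diff_commute by (auto intro!: coset_eq)
    then have "(+) a ` lattice k \<inter> (+) b ` lattice l = (+) z ` lattice l"
      using lattice_antimono[OF that] by auto
    then show ?thesis by (auto simp: cosets_def)
  qed (simp add: cosets_def)
  fix X Y assume "X \<in> cosets" "Y \<in> cosets"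
  then consider "X = {} \<or> Y = {}" | a k b l where "X = (+) a ` lattice k" "Y = (+) b ` lattice l"
    by (auto simp: cosets_def)
  then show "X \<inter> Y \<in> cosets"
  proof cases
    case 2
    then show ?thesis using nested linear by (metis Int_commute)
  qed (auto simp: cosets_def)
qed

text \<open>
  An open set is the union of the cosets that it contains, of which there are countably many.
\<close>

lemma sets_borel_cosets: "sets (borel :: ('p padic ^ 'd) measure) = sigma_sets UNIV cosets"
proof -
  have eq: "(borel :: ('p padic ^ 'd) measure) = sigma UNIV cosets"
    unfolding borel_def
  proof (rule sigma_eqI)
    have "S \<in> sigma_sets UNIV cosets" if S: "open S" for S
    proof -
      have "\<Union>{X \<in> cosets. X \<subseteq> S} = S"
      proof (intro equalityI subsetI)
        fix x assume "x \<in> S"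
        then obtain k where "(+) x ` lattice k \<subseteq> S"
          using open_contains_lattice_coset[OF S] by blast
        moreover have "x \<in> (+) x ` lattice k" by (simp add: mem_coset_iff)
        ultimately show "x \<in> \<Union>{X \<in> cosets. X \<subseteq> S}"
          unfolding cosets_def by blast
      qed blast
      moreover have "\<Union>{X \<in> cosets. X \<subseteq> S} \<in> sigma_sets UNIV cosets"
        using countable_cosets
        by (intro sigma_sets_UNION) (auto intro: countable_subset)
      ultimately show ?thesis by simp
    qed
    moreover have "X \<in> sigma_sets UNIV {S. open S}" if "X \<in> cosets" for X
      using that open_lattice_coset by (auto simp: cosets_def)
    ultimately show "sigma_sets UNIV {S. open S} = sigma_sets UNIV cosets"
      by (intro equalityI sigma_sets_mono) auto
  qed auto
  show ?thesis unfolding eq by (rule sets_measure_of) simp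
qed

lemma lattice_partition:
  "lattice k = (\<Union>n\<in>D. (+) (shifted_digit k n) ` lattice (k + 1))"
  "disjoint_family_on (\<lambda>n. (+) (shifted_digit k n) ` lattice (k + 1)) D"
proof -
  show "lattice k = (\<Union>n\<in>D. (+) (shifted_digit k n) ` lattice (k + 1))"
  proof (intro equalityI subsetI)
    fix z assume "z \<in> lattice k"
    then show "z \<in> (\<Union>n\<in>D. (+) (shifted_digit k n) ` lattice (k + 1))"
      using digit_exists by (simp only: UN_iff mem_coset_iff)
  next
    fix z assume "z \<in> (\<Union>n\<in>D. (+) (shifted_digit k n) ` lattice (k + 1))"
    then obtain n y where "z = shifted_digit k n + y" "y \<in> lattice (k + 1)" by blast
    then show "z \<in> lattice k"
      using lattice_antimono[of k "k + 1"] by (auto intro!: lattice_add shifted_digit_in_lattice)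
  qed
  show "disjoint_family_on (\<lambda>n. (+) (shifted_digit k n) ` lattice (k + 1)) D"
    unfolding disjoint_family_on_def
  proof (intro ballI impI, rule ccontr)
    fix n n' assume n: "n \<in> D" "n' \<in> D" "n \<noteq> n'"
      and "(+) (shifted_digit k n) ` lattice (k + 1) \<inter> (+) (shifted_digit k n') ` lattice (k + 1) \<noteq> {}"
    then obtain z where "z - shifted_digit k n \<in> lattice (k + 1)" "z - shifted_digit k n' \<in> lattice (k + 1)"
      by (metis (no_types) disjoint_iff mem_coset_iff)
    from lattice_diff[OF this(2,1)] have "shifted_digit k n - shifted_digit k n' \<in> lattice (k + 1)"
      by simp
    then have "mat_powi M k *v (vec_of_int n - vec_of_int n') \<in> lattice (k + 1)"
      by (simp only: matrix_vector_mult_diff_distrib)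
    then have "vec_of_int n - vec_of_int n' \<in> lattice 1" by (simp only: mat_powi_mem_lattice_iff)
    then show False using digit_eqI[OF n(1,2)] n(3) by blast
  qed
qed

text \<open>
  A lattice is the disjoint union of $p$ translates of the next one, so translation invariance
  forces the measure to drop by the factor $p$ at each step of the chain, from $1$ at
  $\mathbb{Z}_p^d$.
\<close>

lemma emeasure_lattice_coset:
  assumes haar: "normalized_haar \<mu>"
  shows "emeasure \<mu> ((+) a ` lattice k) = ennreal (real CARD('p) powi (- k))"
proof -
  let ?p = "real CARD('p)"
  have sets: "sets \<mu> = sets borel"
    and translate: "\<And>a E. E \<in> sets borel \<Longrightarrow> emeasure \<mu> ((+) a ` E) = emeasure \<mu> E"
    and unit: "emeasure \<mu> (lattice 0) = 1"
    using haar unfolding normalized_haar_def lattice_0 by auto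
  have meas: "(+) a ` lattice k \<in> sets borel" for a k
    by (rule borel_open[OF open_lattice_coset])
  have lat: "lattice k \<in> sets borel" for k using meas[of 0 k] by simp
  have scale: "emeasure \<mu> (lattice k) = ennreal ?p * emeasure \<mu> (lattice (k + 1))" for k
  proof -
    have "emeasure \<mu> (lattice k) = (\<Sum>n\<in>D. emeasure \<mu> ((+) (shifted_digit k n) ` lattice (k + 1)))"
      by (subst lattice_partition(1), rule sum_emeasure[symmetric])
         (use meas lattice_partition(2) finite_digits in \<open>auto simp: sets\<close>)
    then show ?thesis
      by (simp add: translate[OF lat] card_digits ennreal_of_nat_eq_real_of_nat)
  qed
  have p: "?p > 0" by simp
  have "emeasure \<mu> (lattice k) = ennreal (?p powi (- k))"
  proof (induction k rule: int_induct[where k = 0])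
    case base
    then show ?case by (simp add: unit)
  next
    case (step1 i)
    have "ennreal ?p * emeasure \<mu> (lattice (i + 1)) = ennreal (?p * ?p powi (- (i + 1)))"
      using step1 scale[of i] p power_int_add[of ?p 1 "- (i + 1)"] by simp
    also have "\<dots> = ennreal ?p * ennreal (?p powi (- (i + 1)))"
      by (rule ennreal_mult) (auto simp: zero_le_power_int)
    finally show ?case
      using p ennreal_mult_cancel_left by (metis ennreal_eq_0_iff ennreal_neq_top not_le)
  next
    case (step2 i)
    have "emeasure \<mu> (lattice (i - 1)) = ennreal ?p * ennreal (?p powi (- i))"
      using step2 scale[of "i - 1"] by simp
    also have "\<dots> = ennreal (?p * ?p powi (- i))"
      by (rule ennreal_mult[symmetric]) (auto simp: zero_le_power_int)
    also have "?p * ?p powi (- i) = ?p powi (- (i - 1))"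
      using p power_int_add[of ?p 1 "- i"] by simp
    finally show ?case .
  qed
  then show ?thesis by (simp add: translate[OF lat])
qed

end

section \<open>Maps that are injective off a null set\<close>

text \<open>
  Off the null set \<open>N\<close> the map has an inverse. The preimages of generators under this inverse are
  images of generators under \<open>\<rho>\<close> with \<open>N\<close> removed, so the inverse is measurable and its image measure
  coincides with \<open>\<mu>\<close> on the generator, hence everywhere. Measurability of images of arbitrary sets
  comes out of the measurability of the inverse.
\<close>

lemma emeasure_image_eq_from_generator:
  fixes \<rho> :: "'a \<Rightarrow> 'b"
  assumes gen: "sets \<mu> = sigma_sets UNIV G" "Int_stable G"
    and cover: "C \<subseteq> G" "countable C" "\<Union>C = UNIV" "\<And>X. X \<in> C \<Longrightarrow> emeasure \<mu> X \<noteq> \<infinity>"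
    and complete: "complete_measure \<nu>"
    and space: "space \<nu> = UNIV"
    and image: "\<And>X. X \<in> G \<Longrightarrow> \<rho> ` X \<in> sets \<nu>" "\<And>X. X \<in> G \<Longrightarrow> emeasure \<nu> (\<rho> ` X) = emeasure \<mu> X"
    and null: "N \<in> null_sets \<nu>"
    and inj: "\<And>x y. \<rho> x = \<rho> y \<Longrightarrow> \<rho> x \<notin> N \<Longrightarrow> x = y"
    and E: "E \<in> sets (completion \<mu>)"
  shows "\<rho> ` E \<in> sets \<nu> \<and> emeasure \<nu> (\<rho> ` E) = emeasure (completion \<mu>) E"
proof -
  interpret complete_measure \<nu> by (rule complete)
  define \<Omega> where "\<Omega> = range \<rho> - N"
  have N: "N \<in> sets \<nu>" using null by auto
  have "range \<rho> = (\<Union>X\<in>C. \<rho> ` X)" using cover(3) by blast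
  also have "\<dots> \<in> sets \<nu>" using cover(1,2) image(1) by (intro sets.countable_UN') auto
  finally have \<Omega>: "\<Omega> \<inter> space \<nu> \<in> sets \<nu>" "\<Omega> \<in> sets \<nu>" using N by (auto simp: \<Omega>_def)
  have pre: "inv \<rho> -` X \<inter> \<Omega> = \<rho> ` X - N" for X
  proof (intro equalityI subsetI)
    fix y assume y: "y \<in> inv \<rho> -` X \<inter> \<Omega>"
    then have "\<rho> (inv \<rho> y) = y" unfolding \<Omega>_def by (simp add: f_inv_into_f)
    then have "y \<in> \<rho> ` X" using y by (metis IntD1 image_eqI vimageD)
    with y show "y \<in> \<rho> ` X - N" by (simp add: \<Omega>_def)
  next
    fix y assume "y \<in> \<rho> ` X - N"
    then obtain x where x: "x \<in> X" "y = \<rho> x" "\<rho> x \<notin> N" by blast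
    have "\<rho> (inv \<rho> y) = \<rho> x" using x by (simp add: f_inv_into_f)
    then have "inv \<rho> y = x" using inj x by metis
    with x show "y \<in> inv \<rho> -` X \<inter> \<Omega>" by (simp add: \<Omega>_def)
  qed
  let ?R = "restrict_space \<nu> \<Omega>"
  have space_R: "space ?R = \<Omega>" by (simp add: space_restrict_space space)
  have sets_R: "X \<in> sets ?R \<longleftrightarrow> X \<subseteq> \<Omega> \<and> X \<in> sets \<nu>" for X
    using \<Omega>(1) by (rule sets_restrict_space_iff)
  have minus_N: "\<rho> ` X - N \<subseteq> \<Omega>" for X by (auto simp: \<Omega>_def)
  have meas: "inv \<rho> \<in> ?R \<rightarrow>\<^sub>M \<mu>"
    by (rule measurable_sigma_sets[OF gen(1)])
       (use image(1) N minus_N in \<open>auto simp: space_R pre sets_R\<close>)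
  define \<kappa> where "\<kappa> = distr ?R \<mu> (inv \<rho>)"
  have \<kappa>: "\<rho> ` X - N \<in> sets \<nu>" "emeasure \<kappa> X = emeasure \<nu> (\<rho> ` X - N)" if "X \<in> sets \<mu>" for X
  proof -
    show "\<rho> ` X - N \<in> sets \<nu>"
      using measurable_sets[OF meas that] by (simp add: space_R pre sets_R)
    show "emeasure \<kappa> X = emeasure \<nu> (\<rho> ` X - N)"
      unfolding \<kappa>_def emeasure_distr[OF meas that] space_R pre
      by (rule emeasure_restrict_space[OF \<Omega>(1) minus_N])
  qed
  have "\<kappa> = \<mu>"
  proof (rule measure_eqI_generator_eq_countable[OF gen(2) _ _ _ gen(1) cover(1,3,2)])
    show "G \<subseteq> Pow UNIV" by simp
    show "sets \<kappa> = sigma_sets UNIV G" by (simp add: \<kappa>_def gen(1))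
    show eq: "emeasure \<kappa> X = emeasure \<mu> X" if "X \<in> G" for X
    proof -
      have "X \<in> sets \<mu>" using that by (simp add: gen(1))
      then show ?thesis using \<kappa>(2) emeasure_Diff_null_set[OF null image(1)[OF that]] image(2)[OF that] by simp
    qed
    show "emeasure \<kappa> X \<noteq> \<infinity>" if "X \<in> C" for X
      using eq[of X] cover(1) cover(4)[of X] that by (metis subsetD)
  qed
  then have image_sets: "\<rho> ` X \<in> sets \<nu> \<and> emeasure \<nu> (\<rho> ` X) = emeasure \<mu> X"
    if X: "X \<in> sets \<mu>" for X
  proof -
    have small: "\<rho> ` X \<inter> N \<in> null_sets \<nu>" by (rule complete2[OF Int_lower2 null])
    have split: "\<rho> ` X = (\<rho> ` X - N) \<union> (\<rho> ` X \<inter> N)" by blast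
    have "\<rho> ` X \<in> sets \<nu>"
      by (subst split) (use small \<kappa>(1)[OF X] in blast)
    moreover have "emeasure \<nu> (\<rho> ` X) = emeasure \<mu> X"
      by (subst split) (simp add: emeasure_Un_null_set[OF \<kappa>(1)[OF X] small] \<kappa>(2)[OF X, symmetric] \<open>\<kappa> = \<mu>\<close>)
    ultimately show ?thesis ..
  qed
  obtain S Z Z' where S: "E = S \<union> Z" "Z \<subseteq> Z'" "Z' \<in> null_sets \<mu>" "S \<in> sets \<mu>"
    using E by (rule sets_completionE)
  have "\<rho> ` Z' \<in> null_sets \<nu>" using image_sets[of Z'] S(3) by (simp add: null_sets_def)
  from complete2[OF image_mono[OF S(2)] this] have "\<rho> ` Z \<in> null_sets \<nu>" .
  moreover have "Z \<in> null_sets (completion \<mu>)"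
    using S(2,3) null_sets_completion_iff2 by blast
  ultimately show ?thesis
    using image_sets[OF S(4)] S(4) unfolding S(1) image_Un
    by (simp add: emeasure_Un_null_set sets.Un null_setsD2)
qed

section \<open>The tile and its images\<close>

lemma det_map_matrix_of_int: "det (map_matrix of_int A :: 'a::comm_ring_1 ^ 'n ^ 'n) = of_int (det A)"
  unfolding det_def by simp

lemma vec_of_int_add: "vec_of_int (x + y) = vec_of_int x + vec_of_int y"
  by (simp add: vec_of_int_def vec_eq_iff)

lemma vec_of_int_diff: "vec_of_int (x - y) = vec_of_int x - vec_of_int y"
  by (simp add: vec_of_int_def vec_eq_iff)

lemma vec_of_int_zero [simp]: "vec_of_int 0 = 0"
  by (simp add: vec_of_int_def vec_eq_iff)

lemma vec_of_int_mult:
  "vec_of_int (A *v x) = (map_matrix of_int A :: 'a::comm_ring_1 ^ 'n ^ 'n) *v vec_of_int x"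
  by (simp add: vec_of_int_def vec_eq_iff matrix_vector_mult_def)

text \<open>
  The integer vector $\sum_{i<m} A^{m-1-i}x_i$ of a word, which translates the tile in the image of
  the cell of that word.
\<close>

definition horner :: "int ^ 'd ^ 'd \<Rightarrow> (int ^ 'd) list \<Rightarrow> int ^ 'd" where
  "horner A w = foldl (\<lambda>s n. A *v s + n) 0 w"

lemma horner_snoc [simp]: "horner A (w @ [n]) = A *v horner A w + n"
  and horner_Nil [simp]: "horner A [] = 0"
  by (simp_all add: horner_def)

context
  fixes A :: "int ^ 'd ^ 'd" and D :: "(int ^ 'd) set"
  assumes inv: "invertible (map_matrix of_int A :: real ^ 'd ^ 'd)"
begin

abbreviation rescale :: "int \<Rightarrow> real ^ 'd \<Rightarrow> real ^ 'd" where
  "rescale k \<equiv> (*v) (mat_powi (map_matrix of_int A) k)"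

lemma sum_horner:
  "(\<Sum>n<length w. rescale (- (\<gamma> + int n) - 1) (vec_of_int (w ! n)))
    = rescale (- (\<gamma> + int (length w))) (vec_of_int (horner A w))"
proof (induction w rule: rev_induct)
  case (snoc a w)
  let ?k = "\<gamma> + int (length w)"
  have "(\<Sum>n<length (w @ [a]). rescale (- (\<gamma> + int n) - 1) (vec_of_int ((w @ [a]) ! n)))
      = rescale (- ?k) (vec_of_int (horner A w)) + rescale (- ?k - 1) (vec_of_int a)"
    using snoc by (simp add: nth_append)
  also have "rescale (- ?k) (vec_of_int (horner A w)) = rescale (- ?k - 1) (rescale 1 (vec_of_int (horner A w)))"
    unfolding mat_powi_mult_vec[OF inv] by simp
  also have "\<dots> + rescale (- ?k - 1) (vec_of_int a) = rescale (- ?k - 1) (vec_of_int (horner A (w @ [a])))"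
    by (simp add: vec_of_int_add vec_of_int_mult matrix_vector_right_distrib)
  also have "- ?k - 1 = - (\<gamma> + int (length (w @ [a])))" by simp
  finally show ?case .
qed simp

text \<open>
  Splitting off the first digits of the series leaves $B^{-k}$ applied to a series of the kind that
  defines the tile.
\<close>

lemma prefixed_series_image:
  assumes "w \<in> lists D"
  shows "{y. \<exists>x. (\<forall>n. x n \<in> D) \<and> (\<forall>n<length w. x n = w ! n) \<and>
      (\<lambda>n. rescale (- (\<gamma> + int n) - 1) (vec_of_int (x n))) sums y}
    = (\<lambda>t. rescale (- (\<gamma> + int (length w))) (vec_of_int (horner A w) + t)) ` tile A D"
proof -
  let ?m = "length w" and ?s = "vec_of_int (horner A w) :: real ^ 'd"
  let ?k = "\<gamma> + int ?m"
  have sums_rescale: "(\<lambda>n. rescale k (f n)) sums rescale k y" if "f sums y" for k f y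
    using bounded_linear.sums[OF matrix_vector_mul_bounded_linear that] .
  have split: "(\<lambda>n. rescale (- (\<gamma> + int n) - 1) (vec_of_int (x n))) sums y \<longleftrightarrow>
      (\<lambda>n. rescale (- int n - 1) (vec_of_int (x (n + ?m)))) sums (rescale ?k y - ?s)"
    if x: "\<forall>n<?m. x n = w ! n" for x y
  proof -
    have "(\<Sum>n<?m. rescale (- (\<gamma> + int n) - 1) (vec_of_int (x n))) = rescale (- ?k) ?s"
      using x sum_horner[where w = w and \<gamma> = \<gamma>] by simp
    then have "(\<lambda>n. rescale (- (\<gamma> + int n) - 1) (vec_of_int (x n))) sums y \<longleftrightarrow>
        (\<lambda>n. rescale (- (\<gamma> + int (n + ?m)) - 1) (vec_of_int (x (n + ?m)))) sums (y - rescale (- ?k) ?s)"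
      unfolding sums_iff_shift[where f = "\<lambda>n. rescale (- (\<gamma> + int n) - 1) (vec_of_int (x n))" and n = ?m]
      by simp
    also have "\<dots> \<longleftrightarrow> (\<lambda>n. rescale (- int n - 1) (vec_of_int (x (n + ?m)))) sums (rescale ?k y - ?s)"
    proof
      have exponent: "?k + (- (\<gamma> + int (n + ?m)) - 1) = - int n - 1" for n by simp
      assume "(\<lambda>n. rescale (- (\<gamma> + int (n + ?m)) - 1) (vec_of_int (x (n + ?m)))) sums (y - rescale (- ?k) ?s)"
      from sums_rescale[OF this, of ?k]
      show "(\<lambda>n. rescale (- int n - 1) (vec_of_int (x (n + ?m)))) sums (rescale ?k y - ?s)"
        by (simp only: matrix_vector_mult_diff_distrib mat_powi_mult_vec[OF inv] exponent
            right_minus mat_powi_0 matrix_vector_mul_lid)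
    next
      have exponent: "- ?k + (- int n - 1) = - (\<gamma> + int (n + ?m)) - 1" for n by simp
      assume "(\<lambda>n. rescale (- int n - 1) (vec_of_int (x (n + ?m)))) sums (rescale ?k y - ?s)"
      from sums_rescale[OF this, of "- ?k"]
      show "(\<lambda>n. rescale (- (\<gamma> + int (n + ?m)) - 1) (vec_of_int (x (n + ?m)))) sums (y - rescale (- ?k) ?s)"
        by (simp only: matrix_vector_mult_diff_distrib mat_powi_mult_vec[OF inv] exponent
            left_minus mat_powi_0 matrix_vector_mul_lid)
    qed
    finally show ?thesis .
  qed
  show ?thesis
  proof (intro equalityI subsetI)
    fix y assume "y \<in> {y. \<exists>x. (\<forall>n. x n \<in> D) \<and> (\<forall>n<?m. x n = w ! n) \<and>
      (\<lambda>n. rescale (- (\<gamma> + int n) - 1) (vec_of_int (x n))) sums y}"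
    then obtain x where x: "\<forall>n. x n \<in> D" "\<forall>n<?m. x n = w ! n"
      "(\<lambda>n. rescale (- int n - 1) (vec_of_int (x (n + ?m)))) sums (rescale ?k y - ?s)"
      using split by blast
    then have "rescale ?k y - ?s \<in> tile A D"
      unfolding tile_def by (auto intro!: exI[of _ "\<lambda>n. x (n + ?m)"])
    moreover have "y = rescale (- ?k) (?s + (rescale ?k y - ?s))"
      by (simp add: mat_powi_mult_vec[OF inv])
    ultimately show "y \<in> (\<lambda>t. rescale (- ?k) (?s + t)) ` tile A D" by blast
  next
    fix y assume "y \<in> (\<lambda>t. rescale (- ?k) (?s + t)) ` tile A D"
    then obtain t u where y: "y = rescale (- ?k) (?s + t)" and u: "\<And>n. u n \<in> D"
      "(\<lambda>n. rescale (- int n - 1) (vec_of_int (u n))) sums t"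
      unfolding tile_def by blast
    define x where "x n = (if n < ?m then w ! n else u (n - ?m))" for n
    have "rescale ?k y - ?s = t" unfolding y by (simp add: mat_powi_mult_vec[OF inv])
    then have "(\<lambda>n. rescale (- int n - 1) (vec_of_int (x (n + ?m)))) sums (rescale ?k y - ?s)"
      using u(2) by (simp add: x_def)
    moreover have "\<forall>n<?m. x n = w ! n" by (simp add: x_def)
    moreover have "\<forall>n. x n \<in> D" using u(1) assms by (auto simp: x_def in_lists_conv_set)
    ultimately show "y \<in> {y. \<exists>x. (\<forall>n. x n \<in> D) \<and> (\<forall>n<?m. x n = w ! n) \<and>
      (\<lambda>n. rescale (- (\<gamma> + int n) - 1) (vec_of_int (x n))) sums y}"
      using split by blast
  qed
qed

lemma measure_scaled_tile:
  assumes T: "tile A D \<in> lmeasurable" and one: "measure lebesgue (tile A D) = 1"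
  shows "(\<lambda>t. rescale k (s + t)) ` tile A D \<in> lmeasurable"
    and "measure lebesgue ((\<lambda>t. rescale k (s + t)) ` tile A D) = \<bar>det (map_matrix of_int A :: real ^ 'd ^ 'd)\<bar> powi k"
proof -
  have eq: "(\<lambda>t. rescale k (s + t)) ` tile A D = rescale k ` (+) s ` tile A D" by (simp add: image_image)
  from lmeasurable_linear_image[OF matrix_vector_mul_linear measurable_translation[OF T], of "mat_powi (map_matrix of_int A) k" s]
  show "(\<lambda>t. rescale k (s + t)) ` tile A D \<in> lmeasurable"
    and "measure lebesgue ((\<lambda>t. rescale k (s + t)) ` tile A D) = \<bar>det (map_matrix of_int A :: real ^ 'd ^ 'd)\<bar> powi k"
    unfolding eq by (simp_all add: measure_translation one det_mat_powi[OF inv] power_int_abs)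
qed

text \<open>
  Sorting the series of the tile by their first digit covers the tile by one copy of $B^{-1}T$, up
  to translation, for each digit. As the tile has measure one, there are at least $|\det B|$ of them.
\<close>

lemma abs_det_le_card_digits:
  assumes T: "tile A D \<in> lmeasurable" and one: "measure lebesgue (tile A D) = 1"
    and "finite D"
  shows "\<bar>det (map_matrix of_int A :: real ^ 'd ^ 'd)\<bar> \<le> card D"
proof -
  let ?c = "\<bar>det (map_matrix of_int A :: real ^ 'd ^ 'd)\<bar>"
  let ?T = "\<lambda>n. (\<lambda>t. rescale (- 1) (vec_of_int (horner A [n]) + t)) ` tile A D"
  have "?c > 0" using inv invertible_det_nz by auto
  have "tile A D \<subseteq> (\<Union>n\<in>D. ?T n)"
  proof
    fix y assume "y \<in> tile A D"
    then obtain x where x: "\<And>n. x n \<in> D" "(\<lambda>n. rescale (- int n - 1) (vec_of_int (x n))) sums y"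
      unfolding tile_def by blast
    then have "y \<in> ?T (x 0)"
      using prefixed_series_image[of "[x 0]" 0] by auto
    with x(1) show "y \<in> (\<Union>n\<in>D. ?T n)" by blast
  qed
  then have "1 \<le> measure lebesgue (\<Union>n\<in>D. ?T n)"
    unfolding one[symmetric]
    using assms measure_scaled_tile(1) by (intro measure_mono_fmeasurable fmeasurable.finite_UN) auto
  also have "\<dots> \<le> (\<Sum>n\<in>D. measure lebesgue (?T n))"
    using assms measure_scaled_tile(1) by (intro measure_UNION_le) auto
  also have "\<dots> = card D * inverse ?c"
    by (simp add: measure_scaled_tile(2)[OF T one] power_int_minus)
  finally show ?thesis using \<open>?c > 0\<close> by (simp add: field_simps)
qed

lemma negligible_scaled_tile_overlap:
  assumes overlap: "\<And>k :: int ^ 'd. k \<noteq> 0 \<Longrightarrow>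
      emeasure lebesgue (tile A D \<inter> (\<lambda>y. y + vec_of_int k) ` tile A D) = 0"
    and T: "tile A D \<in> sets lebesgue" and "s \<noteq> s'"
  shows "(\<lambda>t. rescale k (vec_of_int s + t)) ` tile A D \<inter> (\<lambda>t. rescale k (vec_of_int s' + t)) ` tile A D
    \<in> null_sets lebesgue"
proof -
  let ?O = "tile A D \<inter> (\<lambda>y. y + vec_of_int (s' - s)) ` tile A D"
  have "(\<lambda>y. y + vec_of_int (s' - s)) ` tile A D \<in> sets lebesgue"
    using lebesgue_sets_translation[OF T, of "vec_of_int (s' - s)"] by (simp add: add.commute)
  then have "negligible ?O"
    using overlap[of "s' - s"] T \<open>s \<noteq> s'\<close> by (simp add: negligible_iff_null_sets null_sets_def)
  then have "negligible ((+) (vec_of_int s) ` ?O)" by (rule negligible_translation)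
  then have "negligible (rescale k ` (+) (vec_of_int s) ` ?O)"
    using lmeasurable_linear_image[OF matrix_vector_mul_linear] unfolding negligible_iff_measure
    by (metis mult_zero_right)
  moreover have "(\<lambda>t. rescale k (vec_of_int s + t)) ` tile A D \<inter> (\<lambda>t. rescale k (vec_of_int s' + t)) ` tile A D
    \<subseteq> rescale k ` (+) (vec_of_int s) ` ?O"
  proof
    fix y assume "y \<in> (\<lambda>t. rescale k (vec_of_int s + t)) ` tile A D \<inter> (\<lambda>t. rescale k (vec_of_int s' + t)) ` tile A D"
    then obtain t t' where t: "t \<in> tile A D" "t' \<in> tile A D"
      "y = rescale k (vec_of_int s + t)" "y = rescale k (vec_of_int s' + t')" by blast
    have cancel: "rescale (- k) (rescale k v) = v" for v
      by (simp add: mat_powi_mult_vec[OF inv])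
    have "rescale (- k) (rescale k (vec_of_int s + t)) = rescale (- k) (rescale k (vec_of_int s' + t'))"
      using t(3,4) by simp
    then have "vec_of_int s + t = vec_of_int s' + t'" by (simp only: cancel)
    then have "t = t' + vec_of_int (s' - s)" by (simp add: vec_of_int_diff algebra_simps)
    then have "t \<in> ?O" using t by blast
    then show "y \<in> rescale k ` (+) (vec_of_int s) ` ?O" unfolding t(3) by blast
  qed
  ultimately show ?thesis
    using negligible_subset by (metis negligible_iff_null_sets)
qed

end

section \<open>The digit map\<close>

lemma card_le_abs_if_padic_abs_less_1:
  assumes "padic_abs (of_int n :: 'p::prime_card padic) < 1" "n \<noteq> 0"
  shows "int CARD('p) \<le> \<bar>n\<bar>"
proof -
  have "CARD('p) dvd nat \<bar>n\<bar>"
  proof (rule ccontr)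
    assume "\<not> CARD('p) dvd nat \<bar>n\<bar>"
    from padic_abs_of_nat_eq_1[OF this] show False
      using assms(1) unfolding padic_abs_of_int_abs by (simp only: less_irrefl)
  qed
  then have "CARD('p) \<le> nat \<bar>n\<bar>" by (rule dvd_imp_le) (use assms(2) in simp)
  then show ?thesis by linarith
qed

text \<open>
  Modulo $M\mathbb{Z}_p^d$ only the last digit of the word survives, so it is determined; then $M$ is
  cancelled and the argument repeats. Comparing the integer vectors inside $\mathbb{Q}_p^d$ suffices.
\<close>

lemma (in padic_digit_system) horner_inj:
  assumes M: "M = map_matrix of_int A"
    and "w \<in> lists D" "w' \<in> lists D" "length w = length w'"
    and "vec_of_int (horner A w) = (vec_of_int (horner A w') :: 'p padic ^ 'd)"
  shows "w = w'"
  using assms(2-)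
proof (induction w arbitrary: w' rule: rev_induct)
  case (snoc n w)
  obtain v n' where w': "w' = v @ [n']" using snoc.prems(3) by (cases w' rule: rev_exhaust) auto
  let ?s = "vec_of_int (horner A w) :: 'p padic ^ 'd" and ?s' = "vec_of_int (horner A v) :: 'p padic ^ 'd"
  have eq: "M *v ?s + vec_of_int n = M *v ?s' + vec_of_int n'"
    using snoc.prems(4) by (simp add: w' vec_of_int_add vec_of_int_mult M)
  then have "vec_of_int n - vec_of_int n' = M *v (?s' - ?s)"
    by (simp add: matrix_vector_mult_diff_distrib algebra_simps)
  also have "\<dots> \<in> lattice 1"
    using mat_powi_mem_lattice_iff[of 1 "?s' - ?s" 0] lattice_diff[OF digit_in_lattice_0 digit_in_lattice_0]
    by simp
  finally have "n = n'" using snoc.prems(1,2) by (intro digit_eqI) (auto simp: w')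
  then have "M *v ?s = M *v ?s'" using eq by simp
  then have "?s = ?s'" using inj_matrix_vector_mult[OF invertible] by (simp add: inj_eq)
  then have "w = v" using snoc.prems by (intro snoc.IH) (auto simp: w')
  with \<open>n = n'\<close> show ?case by (simp add: w')
qed simp

theorem lemma17:
  fixes \<delta> :: "'p::prime_card padic ^ 'd \<Rightarrow> 'p padic ^ 'd \<Rightarrow> real"
    and A :: "int ^ 'd ^ 'd"
    and D :: "(int ^ 'd) set"
    and \<rho> :: "'p padic ^ 'd \<Rightarrow> real ^ 'd"
    and \<mu> :: "('p padic ^ 'd) measure"
  assumes haar: "normalized_haar \<mu>"
    and metric: "deformed_ultrametric \<delta>"
    and dilation: "is_dilation \<delta> ((*v) (map_matrix of_int A))"
    and det_A: "padic_abs (det (map_matrix of_int A :: 'p padic ^ 'd ^ 'd)) = 1 / real CARD('p)"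
    and digits: "digit_set (map_matrix of_int A :: 'p padic ^ 'd ^ 'd) D"
    and rho: "digit_map A D \<rho>"
    and cond_A: "tile A D \<in> sets lebesgue" "emeasure lebesgue (tile A D) = 1"
    and cond_B: "\<And>k :: int ^ 'd. k \<noteq> 0 \<Longrightarrow>
      emeasure lebesgue (tile A D \<inter> (\<lambda>y. y + vec_of_int k) ` tile A D) = 0"
  shows "\<forall>E \<in> sets (completion \<mu>).
    \<rho> ` E \<in> sets lebesgue \<and> emeasure lebesgue (\<rho> ` E) = emeasure (completion \<mu>) E"
proof -
  let ?M = "map_matrix of_int A :: 'p padic ^ 'd ^ 'd"
  let ?B = "map_matrix of_int A :: real ^ 'd ^ 'd"
  have p: "real CARD('p) > 1" by (rule padic_card_gt_1)
  have det_p: "padic_abs (of_int (det A) :: 'p padic) = 1 / real CARD('p)"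
    using det_A by (simp add: det_map_matrix_of_int)
  have det_nz: "det A \<noteq> 0"
  proof
    assume "det A = 0"
    with det_p p show False by simp
  qed
  have "det ?M \<noteq> 0" using det_A p by auto
  interpret padic_digit_system ?M D
  proof
    show "invertible ?M" using \<open>det ?M \<noteq> 0\<close> by (simp add: invertible_det_nz)
    show "(*v) ?M ` padic_integer_vecs \<subset> padic_integer_vecs"
      by (rule dilation_padic_integer_vecs[OF metric dilation])
    show "\<exists>n. \<forall>x \<in> ((*v) ?M ^^ n) ` padic_integer_vecs. vec_padic_abs x \<le> e" if "0 < e" for e
      by (rule dilation_shrinks[OF metric dilation that])
  qed (rule digits)
  have invB: "invertible ?B"
    using det_nz by (simp add: invertible_det_nz det_map_matrix_of_int)
  have T: "tile A D \<in> lmeasurable" "measure lebesgue (tile A D) = 1"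
    using cond_A by (auto simp: fmeasurable_def measure_def)
  have "\<bar>det ?B\<bar> \<le> real CARD('p)"
    using abs_det_le_card_digits[OF invB T finite_digits] by (simp add: card_digits)
  moreover have "int CARD('p) \<le> \<bar>det A\<bar>"
    using card_le_abs_if_padic_abs_less_1[where 'p = 'p, of "det A"] det_p det_nz p by simp
  then have "real_of_int (int CARD('p)) \<le> real_of_int \<bar>det A\<bar>" by (simp only: of_int_le_iff)
  ultimately have det_B: "\<bar>det ?B\<bar> = real CARD('p)"
    by (simp add: det_map_matrix_of_int)

  let ?Q = "\<lambda>k. (*v) (mat_powi ?B k)"
  define R where "R \<gamma> w = (\<lambda>t. ?Q (- (\<gamma> + int (length w))) (vec_of_int (horner A w) + t)) ` tile A D"
    for \<gamma> w
  have rho_sums: "(\<lambda>n. ?Q (- (\<gamma> + int n) - 1) (vec_of_int (x n))) sums \<rho> z"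
    if "\<And>n. x n \<in> D" "(\<lambda>n. shifted_digit (\<gamma> + int n) (x n)) sums z" for \<gamma> x z
    \<comment> \<open>The digits of \<open>digit_map\<close> are indexed by the exponent instead of the distance from \<open>\<gamma>\<close>.\<close>
    using rho[unfolded digit_map_def, rule_format, of "\<lambda>i. x (nat (i - \<gamma>))" \<gamma> z] that by simp
  have rho_cell: "\<rho> ` cell \<gamma> w = R \<gamma> w" if w: "w \<in> lists D" for \<gamma> w
    unfolding R_def prefixed_series_image[OF invB w, symmetric]
  proof (intro equalityI subsetI)
    fix y assume "y \<in> \<rho> ` cell \<gamma> w"
    then obtain z where z: "y = \<rho> z" "z \<in> cell \<gamma> w" by blast
    then obtain x where x: "\<And>n. x n \<in> D" "\<forall>n<length w. x n = w ! n"
      "(\<lambda>n. shifted_digit (\<gamma> + int n) (x n)) sums z"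
      unfolding mem_cell_iff_expansion[OF w] by blast
    from rho_sums[OF x(1,3)] x(1,2) show "y \<in> {y. \<exists>x. (\<forall>n. x n \<in> D) \<and> (\<forall>n<length w. x n = w ! n) \<and>
        (\<lambda>n. ?Q (- (\<gamma> + int n) - 1) (vec_of_int (x n))) sums y}"
      unfolding z(1) by blast
  next
    fix y assume "y \<in> {y. \<exists>x. (\<forall>n. x n \<in> D) \<and> (\<forall>n<length w. x n = w ! n) \<and>
        (\<lambda>n. ?Q (- (\<gamma> + int n) - 1) (vec_of_int (x n))) sums y}"
    then obtain x where x: "\<And>n. x n \<in> D" "\<forall>n<length w. x n = w ! n"
      "(\<lambda>n. ?Q (- (\<gamma> + int n) - 1) (vec_of_int (x n))) sums y" by blast
    obtain z where z: "(\<lambda>n. shifted_digit (\<gamma> + int n) (x n)) sums z"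
      using digit_series_converges by blast
    have "y = \<rho> z" using sums_unique2[OF x(3) rho_sums[OF x(1) z]] .
    moreover have "z \<in> cell \<gamma> w" using x z by (auto simp: mem_cell_iff_expansion[OF w])
    ultimately show "y \<in> \<rho> ` cell \<gamma> w" by blast
  qed
  have R_measure: "R \<gamma> w \<in> sets lebesgue"
    "emeasure lebesgue (R \<gamma> w) = ennreal (real CARD('p) powi (- (\<gamma> + int (length w))))" for \<gamma> w
    using measure_scaled_tile[OF invB T, of "- (\<gamma> + int (length w))" "vec_of_int (horner A w)"]
    unfolding R_def[symmetric] by (auto simp: emeasure_eq_measure2 det_B)

  \<comment> \<open>Words of equal length and with a common starting exponent: their cells are cosets of the same
    lattice, and any two points are separated by such a pair.\<close>
  define words where "words = {(\<gamma> :: int, w, w'). w \<in> lists D \<and> w' \<in> lists D \<and> length w = length w' \<and> w \<noteq> w'}"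
  define N where "N = (\<Union>(\<gamma>, w, w')\<in>words. R \<gamma> w \<inter> R \<gamma> w')"
  have "countable words"
  proof (rule countable_subset)
    show "words \<subseteq> UNIV \<times> lists D \<times> lists D" by (auto simp: words_def)
    show "countable (UNIV \<times> lists D \<times> lists D :: (int \<times> _) set)"
      using finite_digits by (auto intro: countable_finite)
  qed
  moreover have "R \<gamma> w \<inter> R \<gamma> w' \<in> null_sets lebesgue" if "(\<gamma>, w, w') \<in> words" for \<gamma> w w'
  proof -
    have "horner A w \<noteq> horner A w'"
      using horner_inj[OF refl, of w w'] that by (auto simp: words_def)
    then show ?thesis
      using negligible_scaled_tile_overlap[OF invB cond_B cond_A(1)] that
      unfolding R_def words_def by simp
  qed
  ultimately have N: "N \<in> null_sets lebesgue"
    unfolding N_def by (intro null_sets_UN') auto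
  have inj: "z = z'" if eq: "\<rho> z = \<rho> z'" and "\<rho> z \<notin> N" for z z'
  proof (rule ccontr)
    assume "z \<noteq> z'"
    obtain \<gamma> where \<gamma>: "z \<in> lattice \<gamma>" "z' \<in> lattice \<gamma>"
      using lattice_exhaust[of z] lattice_exhaust[of z'] by (metis linear)
    obtain x where x: "\<And>n. x n \<in> D" "(\<lambda>n. shifted_digit (\<gamma> + int n) (x n)) sums z"
      using digit_expansion_exists[OF \<gamma>(1)] by blast
    obtain x' where x': "\<And>n. x' n \<in> D" "(\<lambda>n. shifted_digit (\<gamma> + int n) (x' n)) sums z'"
      using digit_expansion_exists[OF \<gamma>(2)] by blast
    have "x \<noteq> x'" using x(2) x'(2) \<open>z \<noteq> z'\<close> sums_unique2 by blast
    then obtain n where n: "x n \<noteq> x' n" by blast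
    define w where "w = map x [0..<Suc n]"
    define w' where "w' = map x' [0..<Suc n]"
    have lists: "w \<in> lists D" "w' \<in> lists D" using x(1) x'(1) by (auto simp: w_def w'_def)
    have "z \<in> cell \<gamma> w"
      unfolding mem_cell_iff_expansion[OF lists(1)] using x
      by (intro exI[of _ x]) (simp add: w_def del: upt_Suc)
    moreover have "z' \<in> cell \<gamma> w'"
      unfolding mem_cell_iff_expansion[OF lists(2)] using x'
      by (intro exI[of _ x']) (simp add: w'_def del: upt_Suc)
    ultimately have "\<rho> z \<in> R \<gamma> w \<inter> R \<gamma> w'"
      using rho_cell lists eq by (metis IntI imageI)
    moreover have "(\<gamma>, w, w') \<in> words"
      using lists n by (auto simp: words_def w_def w'_def)
    ultimately show False using \<open>\<rho> z \<notin> N\<close> unfolding N_def by blast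
  qed

  have image: "\<rho> ` X \<in> sets lebesgue \<and> emeasure lebesgue (\<rho> ` X) = emeasure \<mu> X" if coset: "X \<in> cosets" for X
  proof (cases "X = {}")
    case False
    then obtain a k where X: "X = (+) a ` lattice k" using coset by (auto simp: cosets_def)
    obtain \<gamma> w where w: "w \<in> lists D" "\<gamma> + int (length w) = k" "(+) a ` lattice k = cell \<gamma> w"
      by (rule coset_is_cell)
    have "emeasure \<mu> X = ennreal (real CARD('p) powi (- k))"
      unfolding X by (rule emeasure_lattice_coset[OF haar])
    moreover have "\<rho> ` X = R \<gamma> w" unfolding X w(3) by (rule rho_cell[OF w(1)])
    ultimately show ?thesis using R_measure[of \<gamma> w] by (simp add: w(2))
  qed simp
  have sets_mu: "sets \<mu> = sigma_sets UNIV cosets"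
    using haar by (simp add: normalized_haar_def sets_borel_cosets)
  show ?thesis
  proof
    fix E assume E: "E \<in> sets (completion \<mu>)"
    show "\<rho> ` E \<in> sets lebesgue \<and> emeasure lebesgue (\<rho> ` E) = emeasure (completion \<mu>) E"
    proof (rule emeasure_image_eq_from_generator[OF sets_mu Int_stable_cosets _ _ _ _ _ _ _ _ N inj E])
      show "range lattice \<subseteq> cosets"
      proof
        fix X assume "X \<in> range lattice"
        then obtain k where "X = (+) 0 ` lattice k" by auto
        then show "X \<in> cosets" unfolding cosets_def by blast
      qed
      show "\<Union>(range lattice) = (UNIV :: ('p padic ^ 'd) set)" using lattice_exhaust by blast
      show "emeasure \<mu> X \<noteq> \<infinity>" if "X \<in> range lattice" for X
        using that emeasure_lattice_coset[OF haar, of 0] by auto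
      show "complete_measure lebesgue" by (rule completion.complete_measure_axioms)
    qed (use image in \<open>auto simp del: emeasure_completion\<close>)
  qed
qed

end
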